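(* Let $\{e_n\}_{n=1}^{\infty}$ be a Riesz basis of a complex Hilbert space $H$, let $k\in\mathbb{N}$, let $\{f(n)\}_{n=1}^\infty\in\mathcal{S}_k$, and let $A_k$ be the operator on the Hilbert space $H_k(\{e_n\})$ given by $A_k\,(\mathfrak{f})\sum_{n=1}^{\infty}c_ne_n=(\mathfrak{f})\sum_{n=1}^{\infty}if(n)\,c_ne_n$ with domain $D(A_k)=\left\{x=(\mathfrak{f})\sum_{n=1}^{\infty}c_ne_n\in H_k(\{e_n\}):\ \{f(n)c_n\}_{n=1}^\infty\in\ell_2(\Delta^k)\right\}$. Below, $\|\cdot\|$ and $\langle\cdot,\cdot\rangle$ denote the norm and inner product of $H_k(\{e_n\})$ (and the induced operator norm), and $A_k^*$ is the adjoint of $A_k$ in $H_k(\{e_n\})$. Then: 1. For every $a>0$ there exists a constant $C>0$ such that $$\left\|(A_k-\lambda I)^{-1}\right\|\le\frac{C}{|\Re(\lambda)|^{k+1}}\quad\text{for all }\lambda\in\mathbb{C}\text{ with }0<|\Re(\lambda)|<a,$$ $$\left\|(A_k-\lambda I)^{-1}\right\|\le C\quad\text{for all }\lambda\in\mathbb{C}\text{ with }|\Re(\lambda)|\ge a.$$ 2. There exists a constant $M>0$ such that for every $a>0$ and all $x,y\in H_k(\{e_n\})$, for each choice of sign, $$\int_{-\infty}^{\infty}\left|\left\langle (A_k\pm(a+is)I)^{-2}x,y\right\rangle\right|ds\le\frac{M}{a}\left(1+\frac{1}{a^{2k}}\right)\|x\|\,\|y\|.$$ 3. There exists a constant $K>0$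 such that for every $a>0$ and all $x,y\in H_k(\{e_n\})$, for each choice of sign, $$\int_{-\infty}^{\infty}\left\|(A_k\pm(a+is)I)^{-1}x\right\|^2ds\le\frac{K}{a}\left(1+\frac{1}{a^{2k}}\right)\|x\|^2,$$ and $$\int_{-\infty}^{\infty}\left\|(A_k^{*}\pm(a+is)I)^{-1}y\right\|^2ds\le\frac{K}{a}\left(1+\frac{1}{a^{2k}}\right)\|y\|^2.$$
   Context: $\mathbb{N}=\{1,2,3,\dots\}$. The difference operator $\Delta$ acts on scalar sequences by $(\Delta c)_n=c_n-c_{n-1}$, $n\ge 1$, with the convention $c_0=0$; $\Delta^k$ is its $k$-th power, so $(\Delta^k c)_n=\sum_{j=0}^{k}(-1)^j\binom{k}{j}c_{n-j}$ with $c_{m}=0$ for $m\le 0$. Put $\ell_2(\Delta^k)=\{\{c_n\}_{n=1}^{\infty}: \Delta^k\{c_n\}_{n=1}^\infty\in\ell_2\}$. For $k\in\mathbb{N}$, $$\mathcal{S}_k=\Bigl\{\{f(n)\}_{n=1}^{\infty}\subset\mathbb{R}:\ \lim_{n\to\infty}f(n)=+\infty;\ \{n^j\Delta^jf(n)\}_{n=1}^{\infty}\in\ell_\infty\ \text{for } 1\le j\le k\Bigr\}.$$ For a Riesz basis $\{e_n\}_{n=1}^\infty$ of a Hilbert space $H$ with norm $\|\cdot\|_H$, $H_k(\{e_n\})$ is the space of formal series $x=(\mathfrak{f})\sum_{n=1}^{\infty}c_ne_n$ (identified with their coefficient sequences) with $\{c_n\}_{n=1}^\infty\in\ell_2(\Delta^k)$,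 with norm $\|x\|=\left\|\sum_{n=1}^{\infty}(\Delta^k c)_n e_n\right\|_H$, the latter series converging in $H$. With the corresponding inner product it is a separable Hilbert space. It is known that $A_k$ generates a $C_0$-group $\{e^{A_kt}\}_{t\in\mathbb{R}}$ on $H_k(\{e_n\})$, given by $e^{A_kt}(\mathfrak{f})\sum_{n=1}^\infty c_ne_n=(\mathfrak{f})\sum_{n=1}^\infty e^{itf(n)}c_ne_n$. *)

theory Defs
  imports "HOL-Analysis.Analysis"
begin

text \<open>
  A complex Hilbert space is presented as a real Hilbert space (whose real inner product is the
  real part of the complex one, so that norm and topology are the usual ones) with a complex scalar
  multiplication and a Hermitian inner product, linear in its first argument.
\<close>

class complex_inner = real_inner +
  fixes scaleC :: "complex \<Rightarrow> 'a \<Rightarrow> 'a"  (infixr "*\<^sub>C" 75)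
    and cinner :: "'a \<Rightarrow> 'a \<Rightarrow> complex"
  assumes scaleC_add_right: "a *\<^sub>C (x + y) = a *\<^sub>C x + a *\<^sub>C y"
    and scaleC_add_left: "(a + b) *\<^sub>C x = a *\<^sub>C x + b *\<^sub>C x"
    and scaleC_scaleC: "a *\<^sub>C b *\<^sub>C x = (a * b) *\<^sub>C x"
    and scaleC_of_real: "complex_of_real r *\<^sub>C x = r *\<^sub>R x"
    and cinner_commute: "cinner x y = cnj (cinner y x)"
    and cinner_add_left: "cinner (x + y) z = cinner x z + cinner y z"
    and cinner_scaleC_left: "cinner (a *\<^sub>C x) y = a * cinner x y"
    and Re_cinner: "Re (cinner x y) = inner x y"

class complex_hilbert = complex_inner + complete_space

definition bounded_clinear :: "('a::complex_inner \<Rightarrow> 'b::complex_inner) \<Rightarrow> bool" where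
  "bounded_clinear T \<longleftrightarrow> bounded_linear T \<and> (\<forall>a x. T (a *\<^sub>C x) = a *\<^sub>C T x)"

text \<open>
  All sequences indexed by 1, 2, 3, \<dots> are represented by functions on \<^typ>\<open>nat\<close> shifted by one:
  the value of such a function at \<open>n\<close> is the term with index \<open>n + 1\<close>.
\<close>

definition schauder_basis :: "(nat \<Rightarrow> 'a::complex_inner) \<Rightarrow> bool" where
  "schauder_basis e \<longleftrightarrow> (\<forall>x. \<exists>!c. (\<lambda>n. c n *\<^sub>C e n) sums x)"

definition orthonormal_basis :: "(nat \<Rightarrow> 'a::complex_inner) \<Rightarrow> bool" where
  "orthonormal_basis g \<longleftrightarrow>
     (\<forall>m n. cinner (g m) (g n) = (if m = n then 1 else 0)) \<and> schauder_basis g"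

definition riesz_basis :: "(nat \<Rightarrow> 'a::complex_hilbert) \<Rightarrow> bool" where
  "riesz_basis e \<longleftrightarrow>
     (\<exists>(g :: nat \<Rightarrow> 'a) (T :: 'a \<Rightarrow> 'a).
        orthonormal_basis g \<and> bounded_clinear T \<and> bij T \<and> bounded_clinear (inv T) \<and>
        (\<forall>n. e n = T (g n)))"

definition diff_op :: "(nat \<Rightarrow> 'a::ab_group_add) \<Rightarrow> nat \<Rightarrow> 'a" where
  "diff_op c n = c n - (if n = 0 then 0 else c (n - 1))"

definition ell2 :: "(nat \<Rightarrow> complex) set" where
  "ell2 = {c. summable (\<lambda>n. (cmod (c n))\<^sup>2)}"

definition ell2_diff :: "nat \<Rightarrow> (nat \<Rightarrow> complex) set" where
  "ell2_diff k = {c. (diff_op ^^ k) c \<in> ell2}"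

definition S_class :: "nat \<Rightarrow> (nat \<Rightarrow> real) set" where
  "S_class k = {f. filterlim f at_top sequentially \<and>
     (\<forall>j\<in>{1..k}. bounded (range (\<lambda>n. real (n + 1) ^ j * (diff_op ^^ j) f n)))}"

text \<open>
  A formal series is identified with its coefficient sequence, so the vectors of the space
  $H_k(\{e_n\})$ are the elements of \<^term>\<open>ell2_diff k\<close>; the basis enters through the norm and the
  inner product.  For a Riesz basis the series below converges for every such vector.
\<close>

definition Hk_series :: "(nat \<Rightarrow> 'a::complex_hilbert) \<Rightarrow> nat \<Rightarrow> (nat \<Rightarrow> complex) \<Rightarrow> 'a" where
  "Hk_series e k c = (\<Sum>n. (diff_op ^^ k) c n *\<^sub>C e n)"

definition Hk_norm :: "(nat \<Rightarrow> 'a::complex_hilbert) \<Rightarrow> nat \<Rightarrow> (nat \<Rightarrow> complex) \<Rightarrow> real" where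
  "Hk_norm e k x = norm (Hk_series e k x)"

definition Hk_inner ::
    "(nat \<Rightarrow> 'a::complex_hilbert) \<Rightarrow> nat \<Rightarrow> (nat \<Rightarrow> complex) \<Rightarrow> (nat \<Rightarrow> complex) \<Rightarrow> complex" where
  "Hk_inner e k x y = cinner (Hk_series e k x) (Hk_series e k y)"

text \<open>
  A (possibly unbounded, not everywhere defined) operator is identified with its graph; its inverse
  is then the converse relation and the composition of operators is relational composition.
\<close>

type_synonym seq_op = "((nat \<Rightarrow> complex) \<times> (nat \<Rightarrow> complex)) set"

definition op_app :: "seq_op \<Rightarrow> (nat \<Rightarrow> complex) \<Rightarrow> (nat \<Rightarrow> complex)" where
  "op_app T x = (THE y. (x, y) \<in> T)"

text \<open>The operator $T + \mu I$.\<close>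

definition op_shift :: "seq_op \<Rightarrow> complex \<Rightarrow> seq_op" where
  "op_shift T \<mu> = {(x, \<lambda>n. y n + \<mu> * x n) | x y. (x, y) \<in> T}"

text \<open>Everywhere defined bounded linear operators on $H_k(\{e_n\})$, and their operator norm.\<close>

definition Hk_bounded_op :: "(nat \<Rightarrow> 'a::complex_hilbert) \<Rightarrow> nat \<Rightarrow> seq_op \<Rightarrow> bool" where
  "Hk_bounded_op e k T \<longleftrightarrow>
     T \<subseteq> ell2_diff k \<times> ell2_diff k \<and>
     (\<forall>x\<in>ell2_diff k. \<exists>!y. (x, y) \<in> T) \<and>
     (\<forall>x y x' y' \<alpha>. (x, y) \<in> T \<and> (x', y') \<in> T \<longrightarrow>
        (\<lambda>n. \<alpha> * x n + x' n, \<lambda>n. \<alpha> * y n + y' n) \<in> T) \<and>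
     (\<exists>B. \<forall>(x, y)\<in>T. Hk_norm e k y \<le> B * Hk_norm e k x)"

definition Hk_opnorm :: "(nat \<Rightarrow> 'a::complex_hilbert) \<Rightarrow> nat \<Rightarrow> seq_op \<Rightarrow> real" where
  "Hk_opnorm e k T = (SUP x\<in>{x \<in> ell2_diff k. Hk_norm e k x \<le> 1}. Hk_norm e k (op_app T x))"

definition Hk_adjoint :: "(nat \<Rightarrow> 'a::complex_hilbert) \<Rightarrow> nat \<Rightarrow> seq_op \<Rightarrow> seq_op" where
  "Hk_adjoint e k T = {(y, z). y \<in> ell2_diff k \<and> z \<in> ell2_diff k \<and>
     (\<forall>(x, w)\<in>T. Hk_inner e k w y = Hk_inner e k x z)}"

definition A_op :: "(nat \<Rightarrow> real) \<Rightarrow> nat \<Rightarrow> seq_op" where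
  "A_op f k = {(c, \<lambda>n. \<i> * complex_of_real (f n) * c n) | c.
     c \<in> ell2_diff k \<and> (\<lambda>n. complex_of_real (f n) * c n) \<in> ell2_diff k}"

end

(* On coefficient sequences the resolvent is multiplication by m(n) = 1/(i f(n) + mu).  With
   r = |Re mu|, differentiating m g = 1 by the discrete Leibniz rule and using the bounds on
   n^j Delta^j f gives |Delta^j m(n)| <= C n^(-j) |m(n)| (1 + r^(-j)), while Hardy's inequality shows
   that n^(-j) Delta^(k-j) c is square summable whenever Delta^k c is.  Together they yield the
   pointwise domination |Delta^k(m c)(n)| <= C (1 + r^(-k)) |m(n)| q(n) with ||q|| <= ||Delta^k c||.
   All three claims follow from this: |m| <= 1/r, and the integral of |m(n)|^2 over a vertical line at
   distance a from the imaginary axis is pi/a.  For the adjoint the factor |m(n)| is put on the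
   coefficients <e_n, y> instead, and the bound on the squared resolvent is the product of the two
   estimates, so that Plancherel's theorem and the group itself are not needed. *)
theory Submission
  imports Defs "HOL-Probability.Sinc_Integral"
begin

section \<open>Orthonormal and Riesz bases\<close>

text \<open>If every occurrence of the symbol were bounded by 1/r, nothing integrable along a
  vertical line would be left. Hence one factor |m(n)| stays unestimated, and only the further
  copies of m that the Leibniz rule produces are bounded by 1/r. The dominating sequence q depends
  on the vector alone and not on mu, so the squared domination can be integrated term by term.

  The convention c_0 = 0 creates a boundary: for j >= 1 the j-th difference of a constant does not
  vanish at the first j places, so m g = 1 controls Delta^j m only beyond them. In the shifted form
  of the Leibniz rule the factor multiplying Delta^j m is zero at precisely these places, so the
  uncontrolled values never contribute.

  The inner product of H_k mixes coefficients, so the adjoint resolvent has no evident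
  coefficientwise formula. It is reached by duality, from a bound on <R x, y> that is linear in
  ||x|| and whose dependence on mu sits in a sequence determined by y. For the squared resolvent the
  two estimates give a geometric mean of two energies, which a weighted arithmetic mean turns back
  into a single energy.\<close>

instance complex_hilbert \<subseteq> banach ..

section \<open>Sesquilinear calculus and the complex Cauchy-Schwarz inequality\<close>

lemma cinner_add_right: "cinner x (y + z) = cinner x y + cinner (x::'a::complex_inner) z"
  by (metis cinner_commute cinner_add_left complex_cnj_add)

lemma cinner_scaleC_right: "cinner x (a *\<^sub>C y) = cnj a * cinner (x::'a::complex_inner) y"
  by (metis cinner_commute cinner_scaleC_left complex_cnj_mult)

lemma cinner_self: "cinner x x = complex_of_real ((norm (x::'a::complex_inner))\<^sup>2)"
proof -
  have "Im (cinner x x) = 0"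
    using arg_cong[OF cinner_commute[of x x], of Im] by simp
  then show ?thesis
    by (simp add: complex_eq_iff Re_cinner power2_norm_eq_inner)
qed

text \<open>The class ties the norm to the real inner product only, so homogeneity over complex
  scalars has to be read off from the sesquilinearity of \<open>cinner\<close>.\<close>

lemma norm_scaleC: "norm (a *\<^sub>C x) = cmod a * norm (x::'a::complex_inner)"
proof -
  have "complex_of_real ((norm (a *\<^sub>C x))\<^sup>2) = a * cnj a * complex_of_real ((norm x)\<^sup>2)"
    by (simp only: cinner_self[symmetric] cinner_scaleC_left cinner_scaleC_right mult_ac)
  also have "\<dots> = complex_of_real ((cmod a * norm x)\<^sup>2)"
    by (simp add: complex_norm_square[symmetric] power_mult_distrib)
  finally have "(norm (a *\<^sub>C x))\<^sup>2 = (cmod a * norm x)\<^sup>2"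
    by (simp only: of_real_eq_iff)
  then show ?thesis
    by (simp add: power2_eq_iff_nonneg)
qed

lemma cmod_cinner_le: "cmod (cinner x y) \<le> norm x * norm (y::'a::complex_inner)"
proof (cases "cinner x y = 0")
  case False
  define w where "w = cinner x y"
  \<comment> \<open>The phase \<open>u\<close> rotates \<open>w\<close> onto the positive real axis.
    There \<open>cinner\<close> agrees with its real part, so the real Cauchy-Schwarz inequality
    applies to \<open>u *\<^sub>C x\<close> and \<open>y\<close>.\<close>
  define u where "u = cnj w / complex_of_real (cmod w)"
  have w: "w \<noteq> 0" using False by (simp add: w_def)
  have u: "cmod u = 1" using w by (simp add: u_def norm_divide)
  have "u * w = complex_of_real (cmod w)"
    using w complex_norm_square[of w] by (simp add: u_def field_simps power2_eq_square)
  then have "cmod w = Re (cinner (u *\<^sub>C x) y)"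
    by (simp add: cinner_scaleC_left w_def)
  also have "\<dots> \<le> norm (u *\<^sub>C x) * norm y"
    by (simp only: Re_cinner norm_cauchy_schwarz)
  finally show ?thesis by (simp add: norm_scaleC u w_def)
qed simp

lemma cinner_zero [simp]: "cinner 0 (x::'a::complex_inner) = 0" "cinner x (0::'a::complex_inner) = 0"
  using cinner_add_left[of 0 0 x] cinner_add_right[of x 0 0] by simp_all

lemma scaleC_zero [simp]: "0 *\<^sub>C x = (0::'a::complex_inner)" "a *\<^sub>C 0 = (0::'a::complex_inner)"
  using scaleC_add_left[of 0 0 x] scaleC_add_right[of a 0 0] by simp_all

lemma bounded_linear_cinner_left: "bounded_linear (\<lambda>x. cinner x (y::'a::complex_inner))"
proof (rule bounded_linear_intro[where K = "norm y"])
  show "cinner (r *\<^sub>R x) y = r *\<^sub>R cinner x y" for r and x :: 'a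
    by (simp add: scaleC_of_real[symmetric] cinner_scaleC_left scaleR_conv_of_real)
qed (auto simp: cinner_add_left cmod_cinner_le)

lemma bounded_linear_cinner_right: "bounded_linear (\<lambda>y. cinner (x::'a::complex_inner) y)"
proof (rule bounded_linear_intro[where K = "norm x"])
  show "cinner x (r *\<^sub>R y) = r *\<^sub>R cinner x y" for r and y :: 'a
    by (simp add: scaleC_of_real[symmetric] cinner_scaleC_right scaleR_conv_of_real)
qed (use cmod_cinner_le[of x] in \<open>auto simp: cinner_add_right mult.commute\<close>)

lemma bounded_linear_scaleC_right: "bounded_linear (\<lambda>x. a *\<^sub>C (x::'a::complex_inner))"
proof (rule bounded_linear_intro[where K = "cmod a"])
  show "a *\<^sub>C r *\<^sub>R x = r *\<^sub>R a *\<^sub>C x" for r and x :: 'a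
    by (simp add: scaleC_of_real[symmetric] scaleC_scaleC mult.commute)
qed (auto simp: scaleC_add_right norm_scaleC mult.commute)

lemma cinner_extensionality:
  assumes "\<And>u. cinner u x = cinner u (y::'a::complex_inner)"
  shows "x = y"
proof -
  have "cinner (x - y) (x - y) = 0"
    using assms[of "x - y"] by (simp add: bounded_linear.linear[OF bounded_linear_cinner_right] linear_diff)
  then show ?thesis by (simp add: cinner_self)
qed

section \<open>Orthonormal expansions, Riesz representation, and the bounds for a Riesz
  basis\<close>

lemma norm_sum_orthonormal:
  fixes g :: "nat \<Rightarrow> 'a::complex_inner"
  assumes g: "\<And>m n. cinner (g m) (g n) = (if m = n then 1 else 0)" and "finite A"
  shows "(norm (\<Sum>n\<in>A. c n *\<^sub>C g n))\<^sup>2 = (\<Sum>n\<in>A. (cmod (c n))\<^sup>2)"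
proof -
  have "complex_of_real ((norm (\<Sum>n\<in>A. c n *\<^sub>C g n))\<^sup>2)
      = (\<Sum>m\<in>A. \<Sum>n\<in>A. c n * (cnj (c m) * (if n = m then 1 else 0)))"
    by (simp only: cinner_self[symmetric] bounded_linear.linear[OF bounded_linear_cinner_left, THEN linear_sum]
        bounded_linear.linear[OF bounded_linear_cinner_right, THEN linear_sum]
        cinner_scaleC_left cinner_scaleC_right g)
      (simp add: cinner_scaleC_left mult_ac g sum_distrib_left)
  also have "\<dots> = (\<Sum>m\<in>A. c m * cnj (c m))"
    using assms(2) by (intro sum.cong) (simp_all add: if_distrib sum.delta' cong: if_cong)
  also have "\<dots> = complex_of_real (\<Sum>n\<in>A. (cmod (c n))\<^sup>2)"
    by (simp only: complex_norm_square of_real_sum)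
  finally show ?thesis by (simp only: of_real_eq_iff)
qed

lemma sums_orthonormal_norm:
  fixes g :: "nat \<Rightarrow> 'a::complex_inner"
  assumes g: "\<And>m n. cinner (g m) (g n) = (if m = n then 1 else 0)"
    and s: "(\<lambda>n. c n *\<^sub>C g n) sums x"
  shows "(\<lambda>n. (cmod (c n))\<^sup>2) sums (norm x)\<^sup>2"
proof -
  have "(\<lambda>N. (norm (\<Sum>n<N. c n *\<^sub>C g n))\<^sup>2) \<longlonglongrightarrow> (norm x)\<^sup>2"
    using s unfolding sums_def by (intro tendsto_intros)
  then show ?thesis unfolding sums_def by (simp add: norm_sum_orthonormal[OF g])
qed

lemma summable_orthonormal:
  fixes g :: "nat \<Rightarrow> 'a::complex_hilbert"
  assumes g: "\<And>m n. cinner (g m) (g n) = (if m = n then 1 else 0)"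
    and c: "summable (\<lambda>n. (cmod (c n))\<^sup>2)"
  shows "summable (\<lambda>n. c n *\<^sub>C g n)"
  unfolding summable_Cauchy
proof (intro allI impI)
  fix \<epsilon> :: real assume "\<epsilon> > 0"
  then have "\<epsilon>\<^sup>2 > 0" by simp
  then obtain N where N: "\<And>m n. m \<ge> N \<Longrightarrow> norm (\<Sum>n\<in>{m..<n}. (cmod (c n))\<^sup>2) < \<epsilon>\<^sup>2"
    using c unfolding summable_Cauchy by meson
  have "norm (\<Sum>n\<in>{m..<n}. c n *\<^sub>C g n) < \<epsilon>" if "m \<ge> N" for m n
  proof -
    have "(norm (\<Sum>n\<in>{m..<n}. c n *\<^sub>C g n))\<^sup>2 < \<epsilon>\<^sup>2"
      using N[OF that, of n] by (simp add: norm_sum_orthonormal[OF g])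
    then show ?thesis using \<open>\<epsilon> > 0\<close> by (simp add: power2_less_imp_less)
  qed
  then show "\<exists>N. \<forall>m\<ge>N. \<forall>n. norm (sum (\<lambda>n. c n *\<^sub>C g n) {m..<n}) < \<epsilon>" by blast
qed

lemma orthonormal_basis_expansion:
  assumes "orthonormal_basis g"
  obtains c where "(\<lambda>n. c n *\<^sub>C g n) sums x"
  using assms unfolding orthonormal_basis_def schauder_basis_def by metis

lemma bounded_linear_functional:
  fixes \<phi> :: "'a::complex_inner \<Rightarrow> complex"
  assumes "\<And>x y. \<phi> (x + y) = \<phi> x + \<phi> y" "\<And>a x. \<phi> (a *\<^sub>C x) = a * \<phi> x" "\<And>x. cmod (\<phi> x) \<le> N * norm x"
  shows "bounded_linear \<phi>"
proof (rule bounded_linear_intro[where K=N])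
  show "\<phi> (r *\<^sub>R x) = r *\<^sub>R \<phi> x" for r x
    using assms(2)[of "complex_of_real r" x] by (simp add: scaleC_of_real scaleR_conv_of_real)
qed (use assms in \<open>auto simp: mult.commute\<close>)

text \<open>Finite sums suffice: test the functional on the truncations of its own representing vector.\<close>

lemma bessel_functional:
  fixes e :: "nat \<Rightarrow> 'a::complex_inner" and \<phi> :: "'a \<Rightarrow> complex"
  assumes \<phi>: "\<And>x y. \<phi> (x + y) = \<phi> x + \<phi> y" "\<And>a x. \<phi> (a *\<^sub>C x) = a * \<phi> x" "\<And>x. cmod (\<phi> x) \<le> N * norm x" "N \<ge> 0"
    and e: "\<And>c M. (norm (\<Sum>n<M. c n *\<^sub>C e n))\<^sup>2 \<le> B * (\<Sum>n<M. (cmod (c n))\<^sup>2)"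
  shows "summable (\<lambda>n. (cmod (\<phi> (e n)))\<^sup>2)" and "(\<Sum>n. (cmod (\<phi> (e n)))\<^sup>2) \<le> B * N\<^sup>2"
proof -
  have *: "(\<Sum>n<M. (cmod (\<phi> (e n)))\<^sup>2) \<le> B * N\<^sup>2" for M
  proof -
    define S where "S = (\<Sum>n<M. (cmod (\<phi> (e n)))\<^sup>2)"
    define v where "v = (\<Sum>n<M. cnj (\<phi> (e n)) *\<^sub>C e n)"
    have S0: "S \<ge> 0" by (simp add: S_def sum_nonneg)
    have "\<phi> v = (\<Sum>n<M. cnj (\<phi> (e n)) * \<phi> (e n))"
      by (simp add: v_def linear_sum[OF bounded_linear.linear[OF bounded_linear_functional[OF \<phi>(1-3)]]] \<phi>(2))
    also have "\<dots> = complex_of_real S"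
      by (simp add: S_def mult.commute[of "cnj _"] complex_norm_square[symmetric])
    finally have "S \<le> N * norm v" using \<phi>(3)[of v] S0 by simp
    then have "S\<^sup>2 \<le> (N * norm v)\<^sup>2" using S0 by (simp add: power_mono)
    also have "\<dots> \<le> N\<^sup>2 * (B * S)"
      using e[where c="\<lambda>n. cnj (\<phi> (e n))" and M=M]
      by (simp add: power_mult_distrib mult_left_mono v_def S_def)
    finally have le: "S * S \<le> (B * N\<^sup>2) * S" by (simp add: power2_eq_square algebra_simps)
    show ?thesis
    proof (cases "S = 0")
      case True
      \<comment> \<open>For \<open>S = 0\<close> the claim still needs a nonnegative right-hand
        side; the hypothesis for a single unit coefficient supplies the sign of
        \<open>B\<close>.\<close>
      have "B \<ge> 0"
        using e[where c="\<lambda>_. 1" and M=1] order_trans[OF zero_le_power2] by fastforce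
      with True show ?thesis by (simp add: S_def)
    next
      case False
      with S0 le show ?thesis by (simp add: S_def)
    qed
  qed
  show "summable (\<lambda>n. (cmod (\<phi> (e n)))\<^sup>2)"
    by (rule summableI_nonneg_bounded[where x="B * N\<^sup>2"]) (use * in auto)
  then show "(\<Sum>n. (cmod (\<phi> (e n)))\<^sup>2) \<le> B * N\<^sup>2"
    by (rule suminf_le_const) (use * in auto)
qed

text \<open>The representing vector is the explicit series with coefficients
  \<open>cnj (\<phi> (g n))\<close>. The third conclusion expresses its norm through the values of
  \<open>\<phi>\<close> alone; when \<open>\<phi>\<close> depends on a parameter, this later makes
  the norm measurable without treating the vector itself as a measurable function.\<close>

lemma riesz_representation_basis:
  fixes g :: "nat \<Rightarrow> 'a::complex_hilbert" and \<phi> :: "'a \<Rightarrow> complex"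
  assumes g: "orthonormal_basis g"
    and \<phi>: "\<And>x y. \<phi> (x + y) = \<phi> x + \<phi> y" "\<And>a x. \<phi> (a *\<^sub>C x) = a * \<phi> x" "\<And>x. cmod (\<phi> x) \<le> N * norm x" "N \<ge> 0"
  obtains z where "\<And>x. cinner x z = \<phi> x" "norm z \<le> N" "(\<lambda>n. (cmod (\<phi> (g n)))\<^sup>2) sums (norm z)\<^sup>2"
proof -
  have on: "cinner (g m) (g n) = (if m = n then 1 else 0)" for m n
    using g by (simp add: orthonormal_basis_def)
  have "summable (\<lambda>n. (cmod (\<phi> (g n)))\<^sup>2)"
    by (rule bessel_functional(1)[OF \<phi>, where B=1]) (auto simp: norm_sum_orthonormal[OF on])
  then have "summable (\<lambda>n. cnj (\<phi> (g n)) *\<^sub>C g n)"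
    by (intro summable_orthonormal[OF on]) simp
  then obtain z where z: "(\<lambda>n. cnj (\<phi> (g n)) *\<^sub>C g n) sums z" by blast
  have gz: "cinner (g m) z = \<phi> (g m)" for m
  proof -
    have "(\<lambda>n. cinner (g m) (cnj (\<phi> (g n)) *\<^sub>C g n)) sums cinner (g m) z"
      by (rule bounded_linear.sums[OF bounded_linear_cinner_right z])
    moreover have "(\<lambda>n. cinner (g m) (cnj (\<phi> (g n)) *\<^sub>C g n)) = (\<lambda>n. if n = m then \<phi> (g n) else 0)"
      by (auto simp: cinner_scaleC_right on)
    ultimately show ?thesis
      using sums_single[of m "\<lambda>n. \<phi> (g n)"] by (simp add: sums_unique2)
  qed
  have bl: "bounded_linear \<phi>"
    by (rule bounded_linear_functional[OF \<phi>(1-3)])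
  have xz: "cinner x z = \<phi> x" for x
  proof -
    obtain c where c: "(\<lambda>n. c n *\<^sub>C g n) sums x" by (rule orthonormal_basis_expansion[OF g])
    have "(\<lambda>n. c n * \<phi> (g n)) sums cinner x z"
      using bounded_linear.sums[OF bounded_linear_cinner_left c, of z] by (simp add: cinner_scaleC_left gz)
    moreover have "(\<lambda>n. c n * \<phi> (g n)) sums \<phi> x"
      using bounded_linear.sums[OF bl c] by (simp add: \<phi>(2))
    ultimately show ?thesis by (rule sums_unique2)
  qed
  \<comment> \<open>Testing the functional on its own representing vector gives the norm bound after
    cancelling one factor \<open>norm z\<close>.\<close>
  have "(norm z)\<^sup>2 = cmod (\<phi> z)" by (simp add: xz[symmetric] cinner_self norm_power)
  also have "\<dots> \<le> N * norm z" by (rule \<phi>(3))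
  finally have "norm z \<le> N" using \<phi>(4) by (cases "norm z = 0") (auto simp: power2_eq_square)
  moreover have "(\<lambda>n. (cmod (\<phi> (g n)))\<^sup>2) sums (norm z)\<^sup>2"
    using sums_orthonormal_norm[OF on z] by simp
  ultimately show thesis by (rule that[OF xz])
qed

text \<open>Everything is transported from an orthonormal basis by the isomorphism \<open>T\<close>:
  the two-sided comparison uses the bounds of \<open>T\<close> and its inverse, and the last two
  facts are a Bessel inequality derived from the upper comparison on finite sums. They control the
  coefficients against which the resolvent is later paired.\<close>

lemma riesz_basis_bounds:
  fixes e :: "nat \<Rightarrow> 'a::complex_hilbert"
  assumes "riesz_basis e"
  obtains B where "B > 0"
    "\<And>c. summable (\<lambda>n. (cmod (c n))\<^sup>2) \<Longrightarrow> summable (\<lambda>n. c n *\<^sub>C e n)"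
    "\<And>c. summable (\<lambda>n. (cmod (c n))\<^sup>2) \<Longrightarrow>
       (norm (\<Sum>n. c n *\<^sub>C e n))\<^sup>2 \<le> B * (\<Sum>n. (cmod (c n))\<^sup>2)"
    "\<And>c. summable (\<lambda>n. (cmod (c n))\<^sup>2) \<Longrightarrow>
       (\<Sum>n. (cmod (c n))\<^sup>2) \<le> B * (norm (\<Sum>n. c n *\<^sub>C e n))\<^sup>2"
    "\<And>x. \<exists>c. summable (\<lambda>n. (cmod (c n))\<^sup>2) \<and> (\<lambda>n. c n *\<^sub>C e n) sums x"
    "\<And>y. summable (\<lambda>n. (cmod (cinner (e n) y))\<^sup>2)"
    "\<And>y. (\<Sum>n. (cmod (cinner (e n) y))\<^sup>2) \<le> B * (norm y)\<^sup>2"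
proof -
  obtain g T where g: "orthonormal_basis g" and T: "bounded_clinear T" and bij: "bij T"
    and T': "bounded_clinear (inv T)" and e: "\<And>n. e n = T (g n :: 'a)"
    using assms unfolding riesz_basis_def by metis
  have on: "cinner (g m) (g n) = (if m = n then 1 else 0)" for m n
    using g by (simp add: orthonormal_basis_def)
  have bl: "bounded_linear T" "bounded_linear (inv T)" and sc: "T (a *\<^sub>C x) = a *\<^sub>C T x" for a x
    using T T' by (auto simp: bounded_clinear_def)
  obtain K1 where K1: "\<And>x. norm (T x) \<le> norm x * K1"
    using bounded_linear.bounded[OF bl(1)] by blast
  obtain K2 where K2: "\<And>x. norm (inv T x) \<le> norm x * K2"
    using bounded_linear.bounded[OF bl(2)] by blast
  \<comment> \<open>One constant dominating both squared operator bounds; the summand 1 makes it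
    positive, so that dividing by it is possible later.\<close>
  define B where "B = K1\<^sup>2 + K2\<^sup>2 + 1"
  have B: "B > 0" "K1\<^sup>2 \<le> B" "K2\<^sup>2 \<le> B" by (auto simp: B_def add_nonneg_pos)
  have sums: "\<exists>x. (\<lambda>n. c n *\<^sub>C g n) sums x \<and> (\<lambda>n. (cmod (c n))\<^sup>2) sums (norm x)\<^sup>2 \<and> (\<lambda>n. c n *\<^sub>C e n) sums T x"
    if c: "summable (\<lambda>n. (cmod (c n))\<^sup>2)" for c
  proof -
    obtain x where x: "(\<lambda>n. c n *\<^sub>C g n) sums x"
      using summable_orthonormal[OF on c] by blast
    show ?thesis
      using x sums_orthonormal_norm[OF on x] bounded_linear.sums[OF bl(1) x]
      by (auto simp: sc e)
  qed
  have n1: "(norm (T x))\<^sup>2 \<le> B * (norm x)\<^sup>2" for x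
  proof -
    have "(norm (T x))\<^sup>2 \<le> (norm x * K1)\<^sup>2" using K1[of x] by (simp add: power_mono)
    also have "\<dots> \<le> B * (norm x)\<^sup>2" using B by (simp add: power_mult_distrib mult.commute mult_right_mono)
    finally show ?thesis .
  qed
  have n2: "(norm x)\<^sup>2 \<le> B * (norm (T x))\<^sup>2" for x
  proof -
    have "norm x \<le> norm (T x) * K2" using K2[of "T x"] bij by (simp add: bij_is_inj)
    then have "(norm x)\<^sup>2 \<le> (norm (T x) * K2)\<^sup>2" by (simp add: power_mono)
    also have "\<dots> \<le> B * (norm (T x))\<^sup>2" using B by (simp add: power_mult_distrib mult.commute mult_right_mono)
    finally show ?thesis .
  qed
  have fin: "(norm (\<Sum>n<M. c n *\<^sub>C e n))\<^sup>2 \<le> B * (\<Sum>n<M. (cmod (c n))\<^sup>2)" for c M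
  proof -
    have "(\<Sum>n<M. c n *\<^sub>C e n) = T (\<Sum>n<M. c n *\<^sub>C g n)"
      by (simp add: linear_sum[OF bounded_linear.linear[OF bl(1)]] sc e)
    then show ?thesis using n1[of "\<Sum>n<M. c n *\<^sub>C g n"] by (simp add: norm_sum_orthonormal[OF on])
  qed
  note bes = bessel_functional[OF cinner_add_left cinner_scaleC_left _ norm_ge_zero fin]
  show thesis
  proof (rule that[OF B(1)])
    fix c assume "summable (\<lambda>n. (cmod (c n))\<^sup>2)"
    from sums[OF this] obtain x where x: "(\<lambda>n. (cmod (c n))\<^sup>2) sums (norm x)\<^sup>2" "(\<lambda>n. c n *\<^sub>C e n) sums T x"
      by blast
    then have eq: "(\<Sum>n. c n *\<^sub>C e n) = T x" "(\<Sum>n. (cmod (c n))\<^sup>2) = (norm x)\<^sup>2"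
      by (simp_all add: sums_iff)
    show "summable (\<lambda>n. c n *\<^sub>C e n)" using x by (simp add: sums_iff)
    show "(norm (\<Sum>n. c n *\<^sub>C e n))\<^sup>2 \<le> B * (\<Sum>n. (cmod (c n))\<^sup>2)" unfolding eq by (rule n1)
    show "(\<Sum>n. (cmod (c n))\<^sup>2) \<le> B * (norm (\<Sum>n. c n *\<^sub>C e n))\<^sup>2" unfolding eq by (rule n2)
  next
    fix x
    obtain c where c: "(\<lambda>n. c n *\<^sub>C g n) sums inv T x" by (rule orthonormal_basis_expansion[OF g])
    have "(\<lambda>n. c n *\<^sub>C e n) sums x"
      using bounded_linear.sums[OF bl(1) c] bij by (simp add: sc e bij_is_surj surj_f_inv_f)
    with sums_orthonormal_norm[OF on c]
    show "\<exists>c. summable (\<lambda>n. (cmod (c n))\<^sup>2) \<and> (\<lambda>n. c n *\<^sub>C e n) sums x"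
      by (auto simp: sums_iff)
  next
    fix y :: 'a
    have *: "cmod (cinner x y) \<le> norm y * norm x" for x
      using cmod_cinner_le[of x y] by (simp add: mult.commute)
    show "summable (\<lambda>n. (cmod (cinner (e n) y))\<^sup>2)" by (rule bes(1)[OF *])
    show "(\<Sum>n. (cmod (cinner (e n) y))\<^sup>2) \<le> B * (norm y)\<^sup>2" by (rule bes(2)[OF *])
  qed
qed

section \<open>The difference operator and a discrete Hardy inequality\<close>

lemma diff_op_add: "diff_op (\<lambda>n. a n + b n) = (\<lambda>n. diff_op a n + diff_op b n)"
  by (auto simp: diff_op_def)

lemma diff_op_cmult: "diff_op (\<lambda>n. r * a n) = (\<lambda>n. r * (diff_op a n :: 'a::ring))"
  by (auto simp: diff_op_def algebra_simps)

lemma funpow_diff_op_add: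
  "(diff_op ^^ k) (\<lambda>n. a n + b n) = (\<lambda>n. (diff_op ^^ k) a n + (diff_op ^^ k) b n)"
  by (induction k) (simp_all add: diff_op_add)

lemma funpow_diff_op_cmult:
  "(diff_op ^^ k) (\<lambda>n. r * a n) = (\<lambda>n. r * ((diff_op ^^ k) a n :: 'a::ring))"
  by (induction k) (simp_all add: diff_op_cmult)

lemma funpow_diff_op_zero: "(diff_op ^^ k) (\<lambda>n. 0) = (\<lambda>n. 0)"
  by (induction k) (auto simp: diff_op_def)

lemma diff_op_of_real:
  "diff_op (\<lambda>n. of_real (a n)) = (\<lambda>n. of_real (diff_op a n) :: 'a::real_algebra_1)"
  by (auto simp: diff_op_def)

lemma funpow_diff_op_of_real:
  "(diff_op ^^ k) (\<lambda>n. of_real (a n)) = (\<lambda>n. of_real ((diff_op ^^ k) a n) :: 'a::real_algebra_1)"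
  by (induction k) (simp_all add: diff_op_of_real)

text \<open>Because the term before the first is taken to be 0, partial summation inverts
  \<open>diff_op\<close> exactly, with no constant of summation. Injectivity of the powers and the
  Hardy estimate below rest on this.\<close>

lemma sum_diff_op: "(\<Sum>i\<le>n. diff_op c i) = c n"
  by (induction n) (auto simp: diff_op_def)

lemma surj_diff_op: "\<exists>c. diff_op c = b"
proof
  show "diff_op (\<lambda>n. \<Sum>i\<le>n. b i) = b"
  proof
    show "diff_op (\<lambda>n. \<Sum>i\<le>n. b i) n = b n" for n
      by (cases n) (simp_all add: diff_op_def)
  qed
qed

lemma surj_funpow_diff_op: "\<exists>c. (diff_op ^^ k) c = b"
proof (induction k arbitrary: b)
  case (Suc k)
  then show ?case using surj_diff_op[of b] by (metis comp_apply funpow.simps(2))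
qed simp

lemma inj_funpow_diff_op: "(diff_op ^^ k) c = (diff_op ^^ k) d \<Longrightarrow> c = d"
proof (induction k)
  case (Suc k)
  have "(diff_op ^^ k) c = (diff_op ^^ k) d"
  proof
    fix n
    show "(diff_op ^^ k) c n = (diff_op ^^ k) d n"
      using sum_diff_op[of "(diff_op ^^ k) c" n] sum_diff_op[of "(diff_op ^^ k) d" n] Suc.prems by simp
  qed
  then show ?case by (rule Suc.IH)
qed simp

text \<open>Away from the boundary the convention for the term of index 0 does not matter.\<close>

lemma funpow_diff_op_const:
  assumes "j \<ge> 1" "n \<ge> j"
  shows "(diff_op ^^ j) (\<lambda>_. a) n = 0"
  using assms
proof (induction j arbitrary: n rule: nat_induct_at_least)
  case base
  then show ?case by (simp add: diff_op_def)
next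
  case (Suc j)
  then show ?case by (simp add: diff_op_def[of "(diff_op ^^ j) _"])
qed

text \<open>The zero extension matches the convention built into \<open>diff_op\<close>: the latter
  is the identity minus this shift, and hence the two commute.\<close>

definition shift :: "(nat \<Rightarrow> 'a::zero) \<Rightarrow> nat \<Rightarrow> 'a" where
  "shift c n = (if n = 0 then 0 else c (n - 1))"

lemma diff_op_shift: "diff_op (shift c) = shift (diff_op c)"
  by (auto simp: diff_op_def shift_def)

lemma funpow_diff_op_shift: "(diff_op ^^ k) (shift c) = shift ((diff_op ^^ k) c)"
  by (induction k) (simp_all add: diff_op_shift)

lemma funpow_shift: "(shift ^^ j) c n = (if n < j then 0 else c (n - j))"
  by (induction j arbitrary: n) (auto simp: shift_def)

lemma funpow_shift_funpow_diff_op: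
  "(shift ^^ j) ((diff_op ^^ k) (shift c)) = (shift ^^ Suc j) ((diff_op ^^ k) c)"
  by (simp add: funpow_diff_op_shift funpow_swap1)

text \<open>Iterates \<open>\<Delta>(m c)(n) = m(n) \<Delta>c(n) + \<Delta>m(n) c(n - 1)\<close>.
  Carrying the shift with its zero extension makes the formula exact at every \<open>n\<close>,
  including \<open>n < k\<close>, and the summands with \<open>n < j\<close> vanish through the
  second factor.\<close>

lemma leibniz_diff_op:
  fixes m c :: "nat \<Rightarrow> 'a::comm_ring_1"
  shows "(diff_op ^^ k) (\<lambda>n. m n * c n) n =
    (\<Sum>j\<le>k. of_nat (k choose j) * (diff_op ^^ j) m n * (shift ^^ j) ((diff_op ^^ (k - j)) c) n)"
proof (induction k arbitrary: m c n)
  case (Suc k)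
  define F where "F j = (diff_op ^^ j) m n * (shift ^^ j) ((diff_op ^^ (Suc k - j)) c) n" for j
  have "diff_op (\<lambda>n. m n * c n) = (\<lambda>n. m n * diff_op c n + diff_op m n * shift c n)"
    by (auto simp: diff_op_def shift_def algebra_simps)
  then have "(diff_op ^^ Suc k) (\<lambda>n. m n * c n) n
      = (diff_op ^^ k) (\<lambda>n. m n * diff_op c n) n + (diff_op ^^ k) (\<lambda>n. diff_op m n * shift c n) n"
    by (simp add: funpow_Suc_right funpow_diff_op_add del: funpow.simps)
  also have "\<dots> = (\<Sum>j\<le>k. of_nat (k choose j) * F j) + (\<Sum>j\<le>k. of_nat (k choose j) * F (Suc j))"
  proof (intro arg_cong2[where f="(+)"])
    show "(diff_op ^^ k) (\<lambda>n. m n * diff_op c n) n = (\<Sum>j\<le>k. of_nat (k choose j) * F j)"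
      unfolding Suc.IH F_def
    proof (rule sum.cong)
      fix j assume "j \<in> {..k}"
      then have "(diff_op ^^ (k - j)) (diff_op c) = (diff_op ^^ (Suc k - j)) c"
        by (simp add: Suc_diff_le funpow_swap1)
      then show "of_nat (k choose j) * (diff_op ^^ j) m n * (shift ^^ j) ((diff_op ^^ (k - j)) (diff_op c)) n
          = of_nat (k choose j) * ((diff_op ^^ j) m n * (shift ^^ j) ((diff_op ^^ (Suc k - j)) c) n)"
        by (simp add: mult.assoc)
    qed simp
    show "(diff_op ^^ k) (\<lambda>n. diff_op m n * shift c n) n = (\<Sum>j\<le>k. of_nat (k choose j) * F (Suc j))"
      unfolding Suc.IH F_def
      by (intro sum.cong)
        (simp_all add: funpow_shift_funpow_diff_op funpow_swap1 mult.assoc del: funpow.simps, simp add: funpow_swap1)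
  qed
  also have "\<dots> = (\<Sum>j\<le>Suc k. of_nat (Suc k choose j) * F j)"
  proof -
    have "(\<Sum>j\<le>Suc k. of_nat (Suc k choose j) * F j)
        = F 0 + (\<Sum>j\<le>k. (of_nat (k choose j) + of_nat (k choose Suc j)) * F (Suc j))"
      by (subst sum.atMost_Suc_shift) simp
    also have "\<dots> = (\<Sum>j\<le>k. of_nat (k choose j) * F (Suc j)) + (F 0 + (\<Sum>j\<le>k. of_nat (k choose Suc j) * F (Suc j)))"
      by (simp add: distrib_right sum.distrib)
    \<comment> \<open>After Pascal's rule the missing summand \<open>j = Suc k\<close> may be added
      freely, since its coefficient \<open>k choose Suc k\<close> is 0.\<close>
    also have "F 0 + (\<Sum>j\<le>k. of_nat (k choose Suc j) * F (Suc j)) = (\<Sum>j\<le>Suc k. of_nat (k choose j) * F j)"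
      using sum.atMost_Suc_shift[of "\<lambda>j. of_nat (k choose j) * F j" k] by (simp add: binomial_eq_0)
    also have "\<dots> = (\<Sum>j\<le>k. of_nat (k choose j) * F j)" by (simp add: binomial_eq_0)
    finally show ?thesis by (simp add: add.commute)
  qed
  finally show ?case by (simp add: F_def mult.assoc)
qed simp

text \<open>Lets all intermediate powers of \<open>1 / \<bar>Re \<mu>\<bar>\<close> be absorbed by
  the two extreme ones, uniformly for \<open>\<mu>\<close> near to and far from the imaginary
  axis.\<close>

lemma power_le_one_plus_power:
  fixes u :: real
  assumes "u \<ge> 0" "p \<le> q"
  shows "u ^ p \<le> 1 + u ^ q"
proof (cases "u \<le> 1")
  case True
  then show ?thesis using assms power_le_one[of u p] zero_le_power[of u q] by linarith
next
  case False
  then have "u ^ p \<le> u ^ q" using assms by (intro power_increasing) simp_all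
  then show ?thesis by simp
qed

text \<open>The classical telescoping proof: since \<open>v n\<close> equals
  \<open>(n + 1) \<alpha> n - n \<alpha> (n - 1)\<close>, the quantity
  \<open>(\<alpha> n)^2 - 2 v n \<alpha> n\<close> is a telescoping difference of terms
  \<open>n (\<alpha> (n - 1))^2\<close> minus a square, so its sum is never positive.\<close>

lemma hardy_finite:
  fixes v :: "nat \<Rightarrow> real"
  defines "\<alpha> \<equiv> \<lambda>n. (\<Sum>i\<le>n. v i) / real (n + 1)"
  shows "(\<Sum>n<N. (\<alpha> n)\<^sup>2) \<le> 4 * (\<Sum>n<N. (v n)\<^sup>2)"
proof -
  have *: "(\<Sum>n<N. (\<alpha> n)\<^sup>2 - 2 * v n * \<alpha> n) \<le> - (if N = 0 then 0 else real N * (\<alpha> (N - 1))\<^sup>2)" for N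
  proof (induction N)
    case (Suc N)
    have "(\<alpha> N)\<^sup>2 - 2 * v N * \<alpha> N \<le> (if N = 0 then 0 else real N * (\<alpha> (N - 1))\<^sup>2) - real (Suc N) * (\<alpha> N)\<^sup>2"
    proof (cases N)
      case 0
      then show ?thesis by (simp add: \<alpha>_def power2_eq_square)
    next
      case (Suc M)
      have v: "v N = real (N + 1) * \<alpha> N - real N * \<alpha> M"
      proof -
        have "(\<Sum>i\<le>N. v i) = real (N + 1) * \<alpha> N" "(\<Sum>i\<le>M. v i) = real N * \<alpha> M"
          by (simp_all add: \<alpha>_def Suc del: sum.atMost_Suc of_nat_Suc)
        then show ?thesis by (simp add: Suc)
      qed
      have "(\<alpha> N)\<^sup>2 - 2 * v N * \<alpha> N
          = real N * (\<alpha> M)\<^sup>2 - real (Suc N) * (\<alpha> N)\<^sup>2 - real N * (\<alpha> N - \<alpha> M)\<^sup>2"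
        unfolding v by (simp add: power2_eq_square algebra_simps)
      also have "\<dots> \<le> real N * (\<alpha> M)\<^sup>2 - real (Suc N) * (\<alpha> N)\<^sup>2" by simp
      finally show ?thesis by (simp add: Suc)
    qed
    with Suc show ?case by simp
  qed simp
  have "(\<Sum>n<N. (\<alpha> n)\<^sup>2 - 2 * v n * \<alpha> n) \<le> 0"
    by (rule order_trans[OF *]) simp
  \<comment> \<open>Young's inequality \<open>2 v \<alpha> \<le> \<alpha>^2 / 2 + 2 v^2\<close>;
    keeping half of \<open>\<alpha>^2\<close> on the left is what produces the constant 4.\<close>
  moreover have "(\<alpha> n)\<^sup>2 / 2 - 2 * (v n)\<^sup>2 \<le> (\<alpha> n)\<^sup>2 - 2 * v n * \<alpha> n" for n
    using zero_le_power2[of "\<alpha> n - 2 * v n"] by (simp add: power2_eq_square algebra_simps)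
  then have "(\<Sum>n<N. (\<alpha> n)\<^sup>2 / 2 - 2 * (v n)\<^sup>2) \<le> (\<Sum>n<N. (\<alpha> n)\<^sup>2 - 2 * v n * \<alpha> n)"
    by (intro sum_mono)
  ultimately show ?thesis
    by (simp add: sum_subtractf sum_divide_distrib[symmetric] sum_distrib_left[symmetric])
qed

lemma summable_suminf_le:
  fixes u :: "nat \<Rightarrow> real"
  assumes "\<And>n. u n \<ge> 0" "\<And>N. (\<Sum>n<N. u n) \<le> B"
  shows "summable u" "(\<Sum>n. u n) \<le> B"
proof -
  show "summable u" by (rule summableI_nonneg_bounded[OF assms])
  then show "(\<Sum>n. u n) \<le> B" by (rule suminf_le_const) (rule assms(2))
qed

text \<open>Lowering the order of the difference by one is a partial summation, so each step is one
  application of Hardy's inequality, paying one factor \<open>n + 1\<close> and one constant 4. With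
  finite \<open>N\<close> the induction runs without establishing summability at each intermediate
  order.\<close>

lemma hardy_diff_op:
  assumes "i \<le> k"
  shows "(\<Sum>n<N. (cmod ((diff_op ^^ (k - i)) c n) / real (n + 1) ^ i)\<^sup>2)
    \<le> 4 ^ i * (\<Sum>n<N. (cmod ((diff_op ^^ k) c n))\<^sup>2)"
  using assms
proof (induction i)
  case (Suc i)
  define v where "v n = cmod ((diff_op ^^ (k - i)) c n) / real (n + 1) ^ i" for n
  have k: "k - i = Suc (k - Suc i)" using Suc.prems by simp
  have "cmod ((diff_op ^^ (k - Suc i)) c n) / real (n + 1) ^ Suc i \<le> (\<Sum>i\<le>n. v i) / real (n + 1)" for n
  proof -
    have "cmod ((diff_op ^^ (k - Suc i)) c n) \<le> (\<Sum>j\<le>n. cmod ((diff_op ^^ (k - i)) c j))"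
      using norm_sum[of "diff_op ((diff_op ^^ (k - Suc i)) c)" "{..n}"]
      unfolding sum_diff_op by (simp add: k)
    then have "cmod ((diff_op ^^ (k - Suc i)) c n) / real (n + 1) ^ i
        \<le> (\<Sum>j\<le>n. cmod ((diff_op ^^ (k - i)) c j)) / real (n + 1) ^ i"
      by (intro divide_right_mono) simp_all
    \<comment> \<open>The weight \<open>1 / (n + 1) ^ i\<close> decreases in \<open>n\<close>, so it
      may be replaced inside the sum by its larger value at each \<open>j \<le> n\<close>.\<close>
    also have "\<dots> \<le> (\<Sum>j\<le>n. v j)"
      unfolding sum_divide_distrib v_def
      by (intro sum_mono divide_left_mono power_mono mult_pos_pos) auto
    finally show ?thesis
      by (simp only: power_Suc2 divide_divide_eq_left[symmetric] divide_right_mono of_nat_0_le_iff)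
  qed
  then have "(\<Sum>n<N. (cmod ((diff_op ^^ (k - Suc i)) c n) / real (n + 1) ^ Suc i)\<^sup>2)
      \<le> (\<Sum>n<N. ((\<Sum>i\<le>n. v i) / real (n + 1))\<^sup>2)"
    by (intro sum_mono power_mono) auto
  also have "\<dots> \<le> 4 * (\<Sum>n<N. (v n)\<^sup>2)" by (rule hardy_finite)
  also have "\<dots> \<le> 4 ^ Suc i * (\<Sum>n<N. (cmod ((diff_op ^^ k) c n))\<^sup>2)"
    using Suc by (simp add: v_def)
  finally show ?case .
qed simp

section \<open>The resolvent as a multiplier on coefficient sequences\<close>

text \<open>The parameter is the number added to the operator, so the resolvent at
  \<open>\<lambda>\<close> corresponds to \<open>\<mu> = - \<lambda>\<close>; all bounds depend on
  \<open>\<bar>Re \<mu>\<bar>\<close>, which the sign leaves unchanged.\<close>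

definition resolvent_symbol :: "(nat \<Rightarrow> real) \<Rightarrow> complex \<Rightarrow> nat \<Rightarrow> complex" where
  "resolvent_symbol f \<mu> n = 1 / (\<i> * complex_of_real (f n) + \<mu>)"

lemma resolvent_symbol_denom_nz: "Re \<mu> \<noteq> 0 \<Longrightarrow> \<i> * complex_of_real r + \<mu> \<noteq> 0"
  by (auto simp: complex_eq_iff)

lemma cmod_resolvent_symbol_le:
  assumes "Re \<mu> \<noteq> 0"
  shows "cmod (resolvent_symbol f \<mu> n) \<le> 1 / \<bar>Re \<mu>\<bar>"
proof -
  have "\<bar>Re \<mu>\<bar> \<le> cmod (\<i> * complex_of_real (f n) + \<mu>)"
    using abs_Re_le_cmod[of "\<i> * complex_of_real (f n) + \<mu>"] by simp
  then show ?thesis using assms by (simp add: resolvent_symbol_def norm_divide frac_le)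
qed

text \<open>In the difference of the constant product only the term without a difference on the
  denominator contains the top order of the symbol. Solving for it divides by the denominator, that
  is, multiplies by the symbol at \<open>n\<close>, and this factor is the one kept on the right.
  The restriction \<open>n \<ge> j\<close> keeps away from the boundary, where differences of
  constants survive.\<close>

lemma resolvent_symbol_diff_bound:
  fixes f :: "nat \<Rightarrow> real"
  assumes F: "\<And>i n. i \<in> {1..k} \<Longrightarrow> \<bar>real (n + 1) ^ i * (diff_op ^^ i) f n\<bar> \<le> F"
    and "j \<le> k"
  shows "\<exists>C\<ge>0. \<forall>\<mu> n. Re \<mu> \<noteq> 0 \<longrightarrow> n \<ge> j \<longrightarrow>
    cmod ((diff_op ^^ j) (resolvent_symbol f \<mu>) n) * real (n + 1) ^ j
      \<le> C * (1 + (1 / \<bar>Re \<mu>\<bar>) ^ j) * cmod (resolvent_symbol f \<mu> n)"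
  using \<open>j \<le> k\<close>
proof (induction j rule: less_induct)
  case (less j)
  show ?case
  proof (cases "j = 0")
    case True
    then show ?thesis by (intro exI[of _ 1]) auto
  next
    case False
    have "\<forall>i\<in>{..<j}. \<exists>C\<ge>0. \<forall>\<mu> n. Re \<mu> \<noteq> 0 \<longrightarrow> n \<ge> i \<longrightarrow>
      cmod ((diff_op ^^ i) (resolvent_symbol f \<mu>) n) * real (n + 1) ^ i
        \<le> C * (1 + (1 / \<bar>Re \<mu>\<bar>) ^ i) * cmod (resolvent_symbol f \<mu> n)"
      using less by auto
    then obtain C where C: "\<And>i. i < j \<Longrightarrow> C i \<ge> 0"
      "\<And>i \<mu> n. i < j \<Longrightarrow> Re \<mu> \<noteq> 0 \<Longrightarrow> n \<ge> i \<Longrightarrow>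
        cmod ((diff_op ^^ i) (resolvent_symbol f \<mu>) n) * real (n + 1) ^ i
        \<le> C i * (1 + (1 / \<bar>Re \<mu>\<bar>) ^ i) * cmod (resolvent_symbol f \<mu> n)"
      unfolding bchoice_iff by (metis lessThan_iff)
    define D where "D = (\<Sum>i<j. C i)"
    have D: "C i \<le> D" if "i < j" for i
      unfolding D_def by (rule member_le_sum) (use that C(1) in auto)
    have D0: "D \<ge> 0" using C(1) by (auto simp: D_def intro!: sum_nonneg)
    have F0: "F \<ge> 0" using F[of 1 0] False less.prems by fastforce
    \<comment> \<open>The factors: \<open>F\<close> from the differences of the denominator,
      \<open>D\<close> from the induction hypothesis, \<open>(j + 1) ^ j\<close> from moving the
      weight from \<open>n - i\<close> to \<open>n\<close>, and 2 from merging two powers of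
      \<open>u\<close>.\<close>
    define G where "G = F * (D * real (j + 1) ^ j * 2)"
    have G0: "G \<ge> 0" using F0 D0 by (simp add: G_def)
    show ?thesis
    proof (intro exI[of _ "\<Sum>i\<in>{Suc 0..j}. real (j choose i) * G"] conjI allI impI)
      show "0 \<le> (\<Sum>i\<in>{Suc 0..j}. real (j choose i) * G)" using G0 by (intro sum_nonneg) simp
    next
      fix \<mu> :: complex and n assume \<mu>: "Re \<mu> \<noteq> 0" and n: "n \<ge> j"
      define u where "u = 1 / \<bar>Re \<mu>\<bar>"
      have u0: "u \<ge> 0" by (simp add: u_def)
      define m where "m = resolvent_symbol f \<mu>"
      define g where "g = (\<lambda>n. \<i> * complex_of_real (f n) + \<mu>)"
      have gm: "(\<lambda>n. g n * m n) = (\<lambda>_. 1)"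
        using resolvent_symbol_denom_nz[OF \<mu>] by (auto simp: g_def m_def resolvent_symbol_def)
      define t where "t i = of_nat (j choose i) * (diff_op ^^ i) g n * (shift ^^ i) ((diff_op ^^ (j - i)) m) n" for i
      have "0 = (diff_op ^^ j) (\<lambda>n. g n * m n) n"
        using funpow_diff_op_const[of j n 1] False n by (simp add: gm)
      also have "\<dots> = (\<Sum>i\<in>{0..j}. t i)"
        by (simp only: leibniz_diff_op t_def atMost_atLeast0)
      also have "\<dots> = g n * (diff_op ^^ j) m n + (\<Sum>i\<in>{Suc 0..j}. t i)"
        by (subst sum.atLeast_Suc_atMost) (simp_all add: t_def)
      finally have "g n * (diff_op ^^ j) m n = - (\<Sum>i\<in>{Suc 0..j}. t i)"
        by (simp add: eq_neg_iff_add_eq_0)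
      \<comment> \<open>Multiplying by \<open>m n\<close> removes the factor \<open>g n\<close> and
        leaves \<open>m n\<close> standing in front of all remaining terms.\<close>
      then have "m n * (g n * (diff_op ^^ j) m n) = m n * - (\<Sum>i\<in>{Suc 0..j}. t i)" by (rule arg_cong)
      then have "(g n * m n) * (diff_op ^^ j) m n = - m n * (\<Sum>i\<in>{Suc 0..j}. t i)"
        by (simp add: mult_ac)
      then have eq: "(diff_op ^^ j) m n = - m n * (\<Sum>i\<in>{Suc 0..j}. t i)"
        using fun_cong[OF gm, of n] by simp
      have t: "cmod (t i) * real (n + 1) ^ j \<le> real (j choose i) * G * (1 + u ^ j)" if i: "i \<in> {Suc 0..j}" for i
      proof -
        \<comment> \<open>As \<open>i \<ge> 1\<close> and \<open>n \<ge> i\<close>, the constant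
          \<open>\<mu>\<close> contributes nothing; this makes the bound uniform in
          \<open>\<mu>\<close>.\<close>
        have "(diff_op ^^ i) g n = \<i> * complex_of_real ((diff_op ^^ i) f n)"
          unfolding g_def
          using i n by (simp add: funpow_diff_op_add funpow_diff_op_cmult funpow_diff_op_of_real funpow_diff_op_const)
        then have Y: "cmod ((diff_op ^^ i) g n) * real (n + 1) ^ i \<le> F"
          using F[of i n] i less.prems by (simp add: norm_mult abs_mult mult.commute)
        have X: "cmod ((diff_op ^^ (j - i)) m (n - i)) * real (n + 1) ^ (j - i)
          \<le> D * real (j + 1) ^ j * (2 * (1 + u ^ j))"
        proof -
          \<comment> \<open>The induction hypothesis holds at the shifted place
            \<open>n - i\<close>; this compares its weight with the one at \<open>n\<close>.\<close>
          have "real (n + 1) \<le> real (j + 1) * real (n - i + 1)"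
          proof -
            have "n + 1 \<le> (n - i + 1) + j * 1" using i n by auto
            also have "\<dots> \<le> (n - i + 1) + j * (n - i + 1)" by (intro add_left_mono mult_left_mono) auto
            also have "\<dots> = (j + 1) * (n - i + 1)" by simp
            finally show ?thesis by (metis of_nat_le_iff of_nat_mult)
          qed
          then have "real (n + 1) ^ (j - i) \<le> real (j + 1) ^ (j - i) * real (n - i + 1) ^ (j - i)"
            unfolding power_mult_distrib[symmetric] by (rule power_mono) simp
          also have "\<dots> \<le> real (j + 1) ^ j * real (n - i + 1) ^ (j - i)"
            by (intro mult_right_mono power_increasing) auto
          finally have "cmod ((diff_op ^^ (j - i)) m (n - i)) * real (n + 1) ^ (j - i)
            \<le> cmod ((diff_op ^^ (j - i)) m (n - i)) * (real (j + 1) ^ j * real (n - i + 1) ^ (j - i))"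
            by (rule mult_left_mono) simp
          also have "\<dots> = real (j + 1) ^ j * (cmod ((diff_op ^^ (j - i)) m (n - i)) * real (n - i + 1) ^ (j - i))"
            by (rule mult.left_commute)
          also have "\<dots> \<le> real (j + 1) ^ j * (C (j - i) * (1 + u ^ (j - i)) * cmod (m (n - i)))"
            unfolding m_def u_def using i n by (intro mult_left_mono C(2) \<mu>) auto
          \<comment> \<open>Only the inner symbol, at \<open>n - i\<close>, is bounded by
            \<open>u\<close>. The resulting exponents 1 and \<open>j - i + 1\<close> do not exceed
            \<open>j\<close>, because \<open>i \<ge> 1\<close>.\<close>
          also have "\<dots> \<le> real (j + 1) ^ j * (D * (1 + u ^ (j - i)) * u)"
            using i u0 D0 cmod_resolvent_symbol_le[OF \<mu>, of f "n - i"]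
            by (intro mult_left_mono mult_mono D) (auto simp: m_def u_def)
          also have "\<dots> = real (j + 1) ^ j * D * (u ^ 1 + u ^ Suc (j - i))"
            by (simp add: algebra_simps)
          also have "\<dots> \<le> real (j + 1) ^ j * D * ((1 + u ^ j) + (1 + u ^ j))"
            using i D0 by (intro mult_left_mono add_mono power_le_one_plus_power u0) auto
          finally show ?thesis by (simp add: mult_ac)
        qed
        have "cmod (t i) * real (n + 1) ^ j = real (j choose i) *
          ((cmod ((diff_op ^^ i) g n) * real (n + 1) ^ i) *
           (cmod ((diff_op ^^ (j - i)) m (n - i)) * real (n + 1) ^ (j - i)))"
        proof -
          have "real (n + 1) ^ j = real (n + 1) ^ i * real (n + 1) ^ (j - i)"
            unfolding power_add[symmetric] using i by simp
          moreover have "\<not> n < i" using i n by simp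
          ultimately show ?thesis
            by (simp only: t_def norm_mult norm_of_nat funpow_shift if_False mult_ac)
        qed
        also have "\<dots> \<le> real (j choose i) * (F * (D * real (j + 1) ^ j * (2 * (1 + u ^ j))))"
          using F0 by (intro mult_left_mono mult_mono X Y) auto
        finally show ?thesis by (simp only: G_def mult_ac)
      qed
      have "cmod ((diff_op ^^ j) m n) * real (n + 1) ^ j
          = cmod (m n) * (cmod (\<Sum>i\<in>{Suc 0..j}. t i) * real (n + 1) ^ j)"
        by (simp add: eq norm_mult)
      also have "\<dots> \<le> cmod (m n) * ((\<Sum>i\<in>{Suc 0..j}. cmod (t i)) * real (n + 1) ^ j)"
        by (intro mult_left_mono mult_right_mono norm_sum) auto
      also have "\<dots> \<le> cmod (m n) * (\<Sum>i\<in>{Suc 0..j}. real (j choose i) * G * (1 + u ^ j))"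
        unfolding sum_distrib_right by (intro mult_left_mono sum_mono t) auto
      also have "\<dots> = cmod (m n) * ((\<Sum>i\<in>{Suc 0..j}. real (j choose i) * G) * (1 + u ^ j))"
        by (simp only: sum_distrib_right)
      finally show "cmod ((diff_op ^^ j) (resolvent_symbol f \<mu>) n) * real (n + 1) ^ j
        \<le> (\<Sum>i\<in>{Suc 0..j}. real (j choose i) * G) * (1 + (1 / \<bar>Re \<mu>\<bar>) ^ j) * cmod (resolvent_symbol f \<mu> n)"
        by (simp only: m_def u_def mult_ac)
    qed
  qed
qed

lemma sum_shifted: "(\<Sum>n<(N::nat). if n < i then 0 else a (n - i)) = (\<Sum>n<N - i. a n :: 'a::comm_monoid_add)"
proof (induction N)
  case (Suc N)
  then show ?case by (cases "N < i") (simp_all add: Suc_diff_le not_less)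
qed simp

text \<open>The order of the quantifiers matters: \<open>q\<close> is chosen from \<open>c\<close>
  before \<open>\<mu>\<close>, so that it stays fixed while \<open>\<mu>\<close> runs along a line.
  It is a normalised sum of the shifted Hardy sequences of \<open>c\<close>, one for each term of
  the product rule.\<close>

lemma resolvent_multiplier_bound:
  fixes f :: "nat \<Rightarrow> real"
  assumes "f \<in> S_class k"
  shows "\<exists>C>0. \<forall>c\<in>ell2_diff k. \<exists>q. (\<forall>n. q n \<ge> 0) \<and> summable (\<lambda>n. (q n)\<^sup>2) \<and>
    (\<Sum>n. (q n)\<^sup>2) \<le> (\<Sum>n. (cmod ((diff_op ^^ k) c n))\<^sup>2) \<and>
    (\<forall>\<mu> n. Re \<mu> \<noteq> 0 \<longrightarrow> cmod ((diff_op ^^ k) (\<lambda>n. resolvent_symbol f \<mu> n * c n) n)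
       \<le> C * (1 + (1 / \<bar>Re \<mu>\<bar>) ^ k) * cmod (resolvent_symbol f \<mu> n) * q n)"
proof -
  have "\<forall>j\<in>{1..k}. \<exists>B. \<forall>n. \<bar>real (n + 1) ^ j * (diff_op ^^ j) f n\<bar> \<le> B"
    using assms by (auto simp: S_class_def bounded_iff)
  then obtain B where B: "\<And>j n. j \<in> {1..k} \<Longrightarrow> \<bar>real (n + 1) ^ j * (diff_op ^^ j) f n\<bar> \<le> B j"
    unfolding bchoice_iff by blast
  have F: "\<bar>real (n + 1) ^ j * (diff_op ^^ j) f n\<bar> \<le> (\<Sum>j\<in>{1..k}. B j)" if "j \<in> {1..k}" for j n
  proof -
    have "B j \<le> (\<Sum>j\<in>{1..k}. B j)"
      by (rule member_le_sum) (use that B order_trans[OF abs_ge_zero] in blast)+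
    with B[OF that, of n] show ?thesis by linarith
  qed
  have "\<forall>j\<in>{..k}. \<exists>C\<ge>0. \<forall>\<mu> n. Re \<mu> \<noteq> 0 \<longrightarrow> n \<ge> j \<longrightarrow>
    cmod ((diff_op ^^ j) (resolvent_symbol f \<mu>) n) * real (n + 1) ^ j
      \<le> C * (1 + (1 / \<bar>Re \<mu>\<bar>) ^ j) * cmod (resolvent_symbol f \<mu> n)"
    using resolvent_symbol_diff_bound[OF F] by blast
  then obtain C where C: "\<And>j. j \<le> k \<Longrightarrow> C j \<ge> 0"
    "\<And>j \<mu> n. j \<le> k \<Longrightarrow> Re \<mu> \<noteq> 0 \<Longrightarrow> n \<ge> j \<Longrightarrow>
    cmod ((diff_op ^^ j) (resolvent_symbol f \<mu>) n) * real (n + 1) ^ j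
      \<le> C j * (1 + (1 / \<bar>Re \<mu>\<bar>) ^ j) * cmod (resolvent_symbol f \<mu> n)"
    unfolding bchoice_iff by (metis atMost_iff)
  define D where "D = (\<Sum>j\<le>k. real (k choose j) * C j) + 1"
  \<comment> \<open>Squaring a sum of \<open>k + 1\<close> terms costs \<open>k + 1\<close>, and
    each of the \<open>k + 1\<close> Hardy sequences costs at most \<open>4 ^ k\<close>. The total
    is \<open>E^2\<close>, so dividing by \<open>E\<close> makes the norm of \<open>q\<close> at
    most that of the \<open>k\<close>-th difference of \<open>c\<close>.\<close>
  define E where "E = real (k + 1) * 2 ^ k"
  have "0 \<le> (\<Sum>j\<le>k. real (k choose j) * C j)" using C(1) by (intro sum_nonneg) auto
  then have D: "D > 0" "real (k choose j) * C j \<le> D" if "j \<le> k" for j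
    using member_le_sum[of j "{..k}" "\<lambda>j. real (k choose j) * C j"] C(1) that by (auto simp: D_def)
  have E: "E > 0" by (simp add: E_def)
  show ?thesis
  \<comment> \<open>The 2 comes from \<open>1 + u ^ i \<le> 2 * (1 + u ^ k)\<close>, and
    \<open>E\<close> undoes the normalisation of \<open>q\<close>.\<close>
  proof (intro exI[of _ "2 * D * E"] conjI ballI)
    show "2 * D * E > 0" using D[of 0] E by simp
    fix c assume c: "c \<in> ell2_diff k"
    define w where "w i n = (if n < i then 0 else cmod ((diff_op ^^ (k - i)) c (n - i)) / real (n - i + 1) ^ i)" for i n
    have w0: "w i n \<ge> 0" for i n by (simp add: w_def)
    define q where "q n = (\<Sum>i\<le>k. w i n) / E" for n
    have q: "(\<Sum>n<N. (q n)\<^sup>2) \<le> (\<Sum>n. (cmod ((diff_op ^^ k) c n))\<^sup>2)" for N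
    proof -
      let ?S = "\<Sum>n<N. (cmod ((diff_op ^^ k) c n))\<^sup>2"
      have wi: "(\<Sum>n<N. (w i n)\<^sup>2) \<le> 4 ^ k * ?S" if "i \<le> k" for i
      proof -
        have "(\<Sum>n<N. (w i n)\<^sup>2) = (\<Sum>n<(N::nat). if n < i then 0
            else (\<lambda>n. (cmod ((diff_op ^^ (k - i)) c n) / real (n + 1) ^ i)\<^sup>2) (n - i))"
          by (intro sum.cong) (auto simp: w_def)
        also have "\<dots> = (\<Sum>n<N - i. (cmod ((diff_op ^^ (k - i)) c n) / real (n + 1) ^ i)\<^sup>2)"
          by (rule sum_shifted)
        also have "\<dots> \<le> (\<Sum>n<N. (cmod ((diff_op ^^ (k - i)) c n) / real (n + 1) ^ i)\<^sup>2)"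
          by (intro sum_mono2) auto
        also have "\<dots> \<le> 4 ^ i * ?S" by (rule hardy_diff_op[OF that])
        also have "\<dots> \<le> 4 ^ k * ?S"
          using that by (intro mult_right_mono power_increasing sum_nonneg) auto
        finally show ?thesis .
      qed
      have "E\<^sup>2 * (\<Sum>n<N. (q n)\<^sup>2) = (\<Sum>n<N. (\<Sum>i\<le>k. w i n)\<^sup>2)"
        using E by (simp add: q_def sum_distrib_left power_divide)
      also have "\<dots> \<le> (\<Sum>n<N. (\<Sum>i\<le>k. (w i n)\<^sup>2) * real (card {..k}))"
        by (intro sum_mono sum_squared_le_sum_of_squares)
      also have "\<dots> = (\<Sum>n<N. \<Sum>i\<le>k. (w i n)\<^sup>2) * real (k + 1)"
        by (simp only: sum_distrib_right[symmetric] card_atMost Suc_eq_plus1)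
      also have "\<dots> = real (k + 1) * (\<Sum>i\<le>k. \<Sum>n<N. (w i n)\<^sup>2)"
        by (subst sum.swap) (rule mult.commute)
      also have "\<dots> \<le> real (k + 1) * (\<Sum>i\<le>k. 4 ^ k * ?S)"
        by (intro mult_left_mono sum_mono wi) auto
      also have "\<dots> = E\<^sup>2 * ?S"
      proof -
        have "E\<^sup>2 = real (k + 1) * (real (k + 1) * (2 ^ k)\<^sup>2)"
          by (simp only: E_def power_mult_distrib power2_eq_square[of "real (k + 1)"] mult.assoc)
        moreover have "(2 ^ k)\<^sup>2 = (4::real) ^ k"
          by (subst power_mult[symmetric], subst mult.commute, subst power_mult) simp
        ultimately show ?thesis by (simp only: sum_constant card_atMost mult.assoc Suc_eq_plus1)
      qed
      finally have "(\<Sum>n<N. (q n)\<^sup>2) \<le> ?S" using E by simp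
      also have "\<dots> \<le> (\<Sum>n. (cmod ((diff_op ^^ k) c n))\<^sup>2)"
        using c by (intro sum_le_suminf) (auto simp: ell2_diff_def ell2_def)
      finally show ?thesis .
    qed
    show "\<exists>q. (\<forall>n. q n \<ge> 0) \<and> summable (\<lambda>n. (q n)\<^sup>2) \<and>
      (\<Sum>n. (q n)\<^sup>2) \<le> (\<Sum>n. (cmod ((diff_op ^^ k) c n))\<^sup>2) \<and>
      (\<forall>\<mu> n. Re \<mu> \<noteq> 0 \<longrightarrow> cmod ((diff_op ^^ k) (\<lambda>n. resolvent_symbol f \<mu> n * c n) n)
       \<le> 2 * D * E * (1 + (1 / \<bar>Re \<mu>\<bar>) ^ k) * cmod (resolvent_symbol f \<mu> n) * q n)"
    proof (intro exI[of _ q] conjI allI impI)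
      show "q n \<ge> 0" for n using E by (auto simp: q_def intro!: divide_nonneg_pos sum_nonneg w0)
      show "summable (\<lambda>n. (q n)\<^sup>2)" by (rule summable_suminf_le(1)[OF _ q]) simp
      show "(\<Sum>n. (q n)\<^sup>2) \<le> (\<Sum>n. (cmod ((diff_op ^^ k) c n))\<^sup>2)"
        by (rule summable_suminf_le(2)[OF _ q]) simp
      fix \<mu> :: complex and n assume \<mu>: "Re \<mu> \<noteq> 0"
      define u where "u = 1 / \<bar>Re \<mu>\<bar>"
      have u0: "u \<ge> 0" by (simp add: u_def)
      define m where "m = resolvent_symbol f \<mu>"
      have t: "cmod (of_nat (k choose i) * (diff_op ^^ i) m n * (shift ^^ i) ((diff_op ^^ (k - i)) c) n)
        \<le> D * (2 * (1 + u ^ k)) * cmod (m n) * w i n" if i: "i \<le> k" for i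
      proof (cases "n < i")
        case False
        let ?x = "cmod ((diff_op ^^ (k - i)) c (n - i))"
        have "cmod ((diff_op ^^ i) m n) \<le> C i * (1 + u ^ i) * cmod (m n) / real (n + 1) ^ i"
          using C(2)[OF i \<mu>, of n] False by (simp add: m_def u_def pos_le_divide_eq)
        \<comment> \<open>The weight is weakened from \<open>n + 1\<close> to
          \<open>n - i + 1\<close>, the one paired with the shifted \<open>c\<close> in
          \<open>w\<close>.\<close>
        also have "\<dots> \<le> C i * (2 * (1 + u ^ k)) * cmod (m n) / real (n - i + 1) ^ i"
        proof (rule frac_le)
          have "u ^ i \<le> 1 + u ^ k" "0 \<le> u ^ k" using power_le_one_plus_power[OF u0 i] u0 by auto
          then have "1 + u ^ i \<le> 2 * (1 + u ^ k)" by simp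
          then show "C i * (1 + u ^ i) * cmod (m n) \<le> C i * (2 * (1 + u ^ k)) * cmod (m n)"
            using C(1)[OF i] by (intro mult_right_mono mult_left_mono) auto
        qed (use C(1)[OF i] u0 in \<open>auto intro!: power_mono\<close>)
        finally have "real (k choose i) * cmod ((diff_op ^^ i) m n) * ?x
          \<le> real (k choose i) * (C i * (2 * (1 + u ^ k)) * cmod (m n) / real (n - i + 1) ^ i) * ?x"
          by (intro mult_left_mono mult_right_mono) auto
        also have "\<dots> = (real (k choose i) * C i) * ((2 * (1 + u ^ k)) * cmod (m n) * w i n)"
          using False by (simp add: w_def)
        also have "\<dots> \<le> D * ((2 * (1 + u ^ k)) * cmod (m n) * w i n)"
          using u0 by (intro mult_right_mono D i mult_nonneg_nonneg w0) auto
        finally show ?thesis using False by (simp add: norm_mult funpow_shift mult_ac)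
      qed (simp add: funpow_shift w_def)
      have "cmod ((diff_op ^^ k) (\<lambda>n. m n * c n) n) \<le> (\<Sum>i\<le>k. D * (2 * (1 + u ^ k)) * cmod (m n) * w i n)"
        unfolding leibniz_diff_op by (rule order_trans[OF norm_sum]) (intro sum_mono t, simp)
      also have "\<dots> = 2 * D * E * (1 + u ^ k) * cmod (m n) * q n"
        unfolding sum_distrib_left[symmetric] using E by (simp add: q_def mult_ac)
      finally show "cmod ((diff_op ^^ k) (\<lambda>n. resolvent_symbol f \<mu> n * c n) n)
        \<le> 2 * D * E * (1 + (1 / \<bar>Re \<mu>\<bar>) ^ k) * cmod (resolvent_symbol f \<mu> n) * q n"
        by (simp add: m_def u_def)
    qed
  qed
qed

section \<open>Integration along vertical lines\<close>

text \<open>An affine substitution in the integral of \<open>1 / (1 + x^2)\<close>. The value does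
  not depend on \<open>b\<close>, so after inserting \<open>b = f n\<close> every index contributes
  equally, however the numbers \<open>f n\<close> are spaced.\<close>

lemma has_bochner_integral_cauchy_kernel:
  fixes a b \<sigma> :: real
  assumes a: "a > 0" and \<sigma>: "\<sigma> = 1 \<or> \<sigma> = -1"
  shows "integrable lborel (\<lambda>s. 1 / (a\<^sup>2 + (b + \<sigma> * s)\<^sup>2))"
    and "(LINT s|lborel. 1 / (a\<^sup>2 + (b + \<sigma> * s)\<^sup>2)) = pi / a"
proof -
  let ?g = "\<lambda>x::real. inverse (1 + x\<^sup>2)"
  have g: "integrable lborel ?g" "(LINT x|lborel. ?g x) = pi"
    using integrable_inverse_1_plus_square LBINT_inverse_1_plus_square
    by (simp_all add: set_integrable_def interval_lebesgue_integral_def set_lebesgue_integral_def)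
  have eq: "1 / (a\<^sup>2 + (b + \<sigma> * s)\<^sup>2) = (1 / a\<^sup>2) * ?g (b / a + (\<sigma> / a) * s)" for s
  proof -
    have "a\<^sup>2 + (b + \<sigma> * s)\<^sup>2 = a\<^sup>2 * (1 + (b / a + (\<sigma> / a) * s)\<^sup>2)"
      using a by (simp add: power2_eq_square field_simps)
    then show ?thesis by (simp add: field_simps)
  qed
  have ne: "\<sigma> / a \<noteq> 0" and abs: "\<bar>\<sigma> / a\<bar> = 1 / a" using assms by auto
  have int: "integrable lborel (\<lambda>s. ?g (b / a + (\<sigma> / a) * s))"
    using lborel_integrable_real_affine[OF g(1) ne, of "b / a"] by simp
  then show "integrable lborel (\<lambda>s. 1 / (a\<^sup>2 + (b + \<sigma> * s)\<^sup>2))"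
    unfolding eq by (rule integrable_mult_right)
  define I where "I = (LINT s|lborel. ?g (b / a + (\<sigma> / a) * s))"
  have I: "pi = 1 / a * I"
    using lborel_integral_real_affine[OF ne, of ?g "b / a"] unfolding g(2) abs real_scaleR_def I_def .
  have "(LINT s|lborel. 1 / (a\<^sup>2 + (b + \<sigma> * s)\<^sup>2)) = 1 / a\<^sup>2 * I"
    unfolding eq integral_mult_right_zero I_def ..
  also have "\<dots> = 1 / a * I / a" by (simp add: power2_eq_square)
  finally show "(LINT s|lborel. 1 / (a\<^sup>2 + (b + \<sigma> * s)\<^sup>2)) = pi / a" unfolding I .
qed

text \<open>With \<open>p\<close> independent of \<open>\<mu>\<close>, integrating over a vertical
  line affects only the symbol and turns this sum into \<open>pi / a\<close> times the sum of
  \<open>p\<close>.\<close>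

definition resolvent_energy :: "(nat \<Rightarrow> real) \<Rightarrow> complex \<Rightarrow> (nat \<Rightarrow> real) \<Rightarrow> real" where
  "resolvent_energy f \<mu> p = (\<Sum>n. (cmod (resolvent_symbol f \<mu> n))\<^sup>2 * p n)"

lemma resolvent_energy_bounds:
  assumes p: "\<And>n. p n \<ge> 0" "summable p" and \<mu>: "Re \<mu> \<noteq> 0"
  shows "summable (\<lambda>n. (cmod (resolvent_symbol f \<mu> n))\<^sup>2 * p n)"
    and "0 \<le> resolvent_energy f \<mu> p"
    and "resolvent_energy f \<mu> p \<le> (1 / \<bar>Re \<mu>\<bar>)\<^sup>2 * (\<Sum>n. p n)"
proof -
  have le: "(cmod (resolvent_symbol f \<mu> n))\<^sup>2 * p n \<le> (1 / \<bar>Re \<mu>\<bar>)\<^sup>2 * p n" for n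
    by (intro mult_right_mono power_mono cmod_resolvent_symbol_le \<mu> p) simp
  have s: "summable (\<lambda>n. (1 / \<bar>Re \<mu>\<bar>)\<^sup>2 * p n)" by (rule summable_mult[OF p(2)])
  show *: "summable (\<lambda>n. (cmod (resolvent_symbol f \<mu> n))\<^sup>2 * p n)"
    by (rule summable_comparison_test'[OF s]) (use le p(1) in \<open>auto simp: abs_mult\<close>)
  show "0 \<le> resolvent_energy f \<mu> p"
    unfolding resolvent_energy_def by (rule suminf_nonneg[OF *]) (simp add: p(1))
  show "resolvent_energy f \<mu> p \<le> (1 / \<bar>Re \<mu>\<bar>)\<^sup>2 * (\<Sum>n. p n)"
    unfolding resolvent_energy_def suminf_mult[OF p(2), symmetric] by (rule suminf_le[OF le * s])
qed

lemma integral_resolvent_energy: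
  fixes \<sigma> :: complex
  assumes p: "\<And>n. p n \<ge> 0" "summable p" and a: "a > 0" and \<sigma>: "\<sigma> \<in> {1, -1}"
  shows "integrable lborel (\<lambda>s. resolvent_energy f (\<sigma> * Complex a s) p)"
    and "(LINT s|lborel. resolvent_energy f (\<sigma> * Complex a s) p) = pi / a * (\<Sum>n. p n)"
proof -
  have Re\<sigma>: "Re \<sigma> = 1 \<or> Re \<sigma> = -1" "Re (\<sigma> * Complex a s) \<noteq> 0" for s using \<sigma> a by auto
  have eq: "(cmod (resolvent_symbol f (\<sigma> * Complex a s) n))\<^sup>2 = 1 / (a\<^sup>2 + (f n + Re \<sigma> * s)\<^sup>2)" for s n
  proof -
    have "(cmod (\<i> * complex_of_real (f n) + \<sigma> * Complex a s))\<^sup>2 = a\<^sup>2 + (f n + Re \<sigma> * s)\<^sup>2"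
      unfolding cmod_power2 using \<sigma> by (auto simp: power2_eq_square algebra_simps)
    then show ?thesis by (simp add: resolvent_symbol_def norm_divide power_divide)
  qed
  note K = has_bochner_integral_cauchy_kernel[OF a Re\<sigma>(1)]
  let ?F = "\<lambda>n s. 1 / (a\<^sup>2 + (f n + Re \<sigma> * s)\<^sup>2) * p n"
  have E: "resolvent_energy f (\<sigma> * Complex a s) p = (\<Sum>n. ?F n s)" for s
    by (simp add: resolvent_energy_def eq)
  have i: "integrable lborel (?F n)" for n by (rule integrable_mult_left[OF K(1)])
  have v: "(LINT s|lborel. ?F n s) = pi / a * p n" for n by (simp only: integral_mult_left_zero K(2))
  have nn: "norm (?F n s) = ?F n s" for n s by (simp add: p(1) sum_nonneg)
  have s1: "AE s in lborel. summable (\<lambda>n. norm (?F n s))"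
    using resolvent_energy_bounds(1)[OF p Re\<sigma>(2), of f] unfolding eq nn by (simp del: times_divide_eq_left)
  have s2: "summable (\<lambda>n. LINT s|lborel. norm (?F n s))"
    unfolding nn v by (rule summable_mult[OF p(2)])
  show "integrable lborel (\<lambda>s. resolvent_energy f (\<sigma> * Complex a s) p)"
    unfolding E by (rule integrable_suminf[OF i s1 s2])
  show "(LINT s|lborel. resolvent_energy f (\<sigma> * Complex a s) p) = pi / a * (\<Sum>n. p n)"
    unfolding E integral_suminf[OF i s1 s2] v by (rule suminf_mult[OF p(2)])
qed

section \<open>Measurability of coefficients, conjugate symbols, and Cauchy-Schwarz for
  series\<close>

lemma borel_measurable_funpow_diff_op:
  assumes "\<And>n. (\<lambda>s. c s n) \<in> borel_measurable M"
  shows "(\<lambda>s. (diff_op ^^ k) (c s) n :: complex) \<in> borel_measurable M"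
proof (induction k arbitrary: n)
  case (Suc k)
  then show ?case by (simp add: diff_op_def[of "(diff_op ^^ k) _"])
qed (simp add: assms)

lemma borel_measurable_resolvent_symbol:
  assumes "\<sigma> \<in> {1, -1}" "a > 0"
  shows "(\<lambda>s. resolvent_symbol f (\<sigma> * Complex a s) n) \<in> borel_measurable lborel"
proof -
  have "continuous_on UNIV (\<lambda>s. resolvent_symbol f (\<sigma> * Complex a s) n)"
    unfolding resolvent_symbol_def Complex_eq
  proof (intro continuous_intros ballI)
    fix s
    show "\<i> * complex_of_real (f n) + \<sigma> * (complex_of_real a + \<i> * complex_of_real s) \<noteq> 0"
      using assms by (auto simp: complex_eq_iff)
  qed
  then show ?thesis by (simp add: borel_measurable_continuous_onI)
qed

text \<open>The adjoint brings in the symbol at \<open>cnj \<mu>\<close>. Trading the conjugation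
  for a sign of \<open>f\<close> returns to the line \<open>\<sigma> * Complex a s\<close>, where
  the integral is known for every real sequence \<open>f\<close>.\<close>

lemma resolvent_symbol_cnj:
  "resolvent_symbol f (cnj \<mu>) n = cnj (resolvent_symbol (\<lambda>n. - f n) \<mu> n)"
  by (simp add: resolvent_symbol_def)

lemma resolvent_energy_cnj: "resolvent_energy f (cnj \<mu>) p = resolvent_energy (\<lambda>n. - f n) \<mu> p"
  by (simp add: resolvent_energy_def resolvent_symbol_cnj)

lemma cauchy_schwarz_suminf:
  fixes a b :: "nat \<Rightarrow> real"
  assumes "\<And>n. a n \<ge> 0" "\<And>n. b n \<ge> 0" "summable (\<lambda>n. (a n)\<^sup>2)" "summable (\<lambda>n. (b n)\<^sup>2)"
  shows "summable (\<lambda>n. a n * b n)" "(\<Sum>n. a n * b n)\<^sup>2 \<le> (\<Sum>n. (a n)\<^sup>2) * (\<Sum>n. (b n)\<^sup>2)"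
proof -
  let ?A = "\<Sum>n. (a n)\<^sup>2" and ?B = "\<Sum>n. (b n)\<^sup>2"
  have AB: "?A \<ge> 0" "?B \<ge> 0" using assms by (auto intro: suminf_nonneg)
  have fin: "(\<Sum>n<N. a n * b n) \<le> sqrt (?A * ?B)" for N
  proof (rule real_le_rsqrt)
    have "(\<Sum>n<N. a n * b n)\<^sup>2 \<le> (\<Sum>n<N. (a n)\<^sup>2) * (\<Sum>n<N. (b n)\<^sup>2)"
      by (rule Cauchy_Schwarz_ineq_sum)
    also have "\<dots> \<le> ?A * ?B"
      using assms AB by (intro mult_mono sum_le_suminf sum_nonneg) auto
    finally show "(\<Sum>n<N. a n * b n)\<^sup>2 \<le> ?A * ?B" .
  qed
  have nn: "a n * b n \<ge> 0" for n using assms by simp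
  show s: "summable (\<lambda>n. a n * b n)" by (rule summable_suminf_le(1)[OF nn fin])
  have "(\<Sum>n. a n * b n)\<^sup>2 \<le> (sqrt (?A * ?B))\<^sup>2"
    by (intro power_mono summable_suminf_le(2)[OF nn fin] suminf_nonneg[OF s nn])
  then show "(\<Sum>n. a n * b n)\<^sup>2 \<le> ?A * ?B" using AB by simp
qed

section \<open>The Hilbert space of formal series\<close>

lemma ell2_lincomb:
  assumes "a \<in> ell2" "b \<in> ell2"
  shows "(\<lambda>n. \<alpha> * a n + b n) \<in> ell2"
proof -
  have s: "summable (\<lambda>n. 2 * (cmod \<alpha>)\<^sup>2 * (cmod (a n))\<^sup>2 + 2 * (cmod (b n))\<^sup>2)"
    using assms by (intro summable_add summable_mult) (simp_all add: ell2_def)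
  have "(cmod (\<alpha> * a n + b n))\<^sup>2 \<le> 2 * (cmod \<alpha>)\<^sup>2 * (cmod (a n))\<^sup>2 + 2 * (cmod (b n))\<^sup>2" for n
  proof -
    have "(cmod (\<alpha> * a n + b n))\<^sup>2 \<le> (cmod (\<alpha> * a n) + cmod (b n))\<^sup>2"
      by (intro power_mono norm_triangle_ineq) simp
    also have "\<dots> \<le> 2 * (cmod (\<alpha> * a n))\<^sup>2 + 2 * (cmod (b n))\<^sup>2"
      using zero_le_power2[of "cmod (\<alpha> * a n) - cmod (b n)"] by (simp add: power2_eq_square algebra_simps)
    finally show ?thesis by (simp add: norm_mult power_mult_distrib)
  qed
  then show ?thesis
    unfolding ell2_def by (auto intro: summable_comparison_test'[OF s])
qed

lemma funpow_diff_op_lincomb: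
  "(diff_op ^^ k) (\<lambda>n. \<alpha> * x n + y n) = (\<lambda>n. \<alpha> * (diff_op ^^ k) x n + (diff_op ^^ k) y n :: 'a::ring)"
  by (simp add: funpow_diff_op_add funpow_diff_op_cmult)

lemma ell2_diff_lincomb:
  "x \<in> ell2_diff k \<Longrightarrow> y \<in> ell2_diff k \<Longrightarrow> (\<lambda>n. \<alpha> * x n + y n) \<in> ell2_diff k"
  by (simp add: ell2_diff_def funpow_diff_op_lincomb ell2_lincomb)

lemma zero_in_ell2_diff: "(\<lambda>n. 0) \<in> ell2_diff k"
  by (simp add: ell2_diff_def ell2_def funpow_diff_op_zero)

lemma ell2_diff_iff: "x \<in> ell2_diff k \<longleftrightarrow> summable (\<lambda>n. (cmod ((diff_op ^^ k) x n))\<^sup>2)"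
  by (simp add: ell2_diff_def ell2_def)

lemma op_app_graph: "x \<in> X \<Longrightarrow> op_app {(x, S x) |x. x \<in> X} x = S x"
  by (simp add: op_app_def)

lemma Hk_bounded_op_graph:
  assumes "\<And>x. x \<in> ell2_diff k \<Longrightarrow> S x \<in> ell2_diff k"
    and "\<And>\<alpha> x y. x \<in> ell2_diff k \<Longrightarrow> y \<in> ell2_diff k \<Longrightarrow> S (\<lambda>n. \<alpha> * x n + y n) = (\<lambda>n. \<alpha> * S x n + S y n)"
    and "\<And>x. x \<in> ell2_diff k \<Longrightarrow> Hk_norm e k (S x) \<le> N * Hk_norm e k x"
  shows "Hk_bounded_op e k {(x, S x) |x. x \<in> ell2_diff k}"
  unfolding Hk_bounded_op_def using assms by (auto simp: ell2_diff_lincomb)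

lemma Hk_opnorm_graph_le:
  assumes "\<And>x. x \<in> ell2_diff k \<Longrightarrow> Hk_norm e k (S x) \<le> N * Hk_norm e k x" "N \<ge> 0"
  shows "Hk_opnorm e k {(x, S x) |x. x \<in> ell2_diff k} \<le> N"
  unfolding Hk_opnorm_def
proof (rule cSUP_least)
  have "(\<lambda>n. 0) \<in> {x \<in> ell2_diff k. Hk_norm e k x \<le> 1}"
    by (simp add: zero_in_ell2_diff Hk_norm_def Hk_series_def funpow_diff_op_zero)
  then show "{x \<in> ell2_diff k. Hk_norm e k x \<le> 1} \<noteq> {}" by blast
next
  fix x assume x: "x \<in> {x \<in> ell2_diff k. Hk_norm e k x \<le> 1}"
  then have "Hk_norm e k (S x) \<le> N * 1"
    using assms order_trans mult_left_mono by (metis (no_types, lifting) mem_Collect_eq)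
  then show "Hk_norm e k (op_app {(x, S x) |x. x \<in> ell2_diff k} x) \<le> N"
    using x by (simp add: op_app_graph)
qed

locale Hk_space =
  fixes e :: "nat \<Rightarrow> 'h::complex_hilbert" and k :: nat
  assumes riesz: "riesz_basis e"
begin

abbreviation X where "X \<equiv> ell2_diff k"
text \<open>The facts below make this a linear bijection onto the Hilbert space of \<open>e\<close>
  that carries \<open>Hk_norm\<close> and \<open>Hk_inner\<close> to its norm and inner product, so
  that abstract arguments can be made there and pulled back.\<close>

abbreviation J where "J \<equiv> Hk_series e k"

lemma J_sums: "x \<in> X \<Longrightarrow> (\<lambda>n. (diff_op ^^ k) x n *\<^sub>C e n) sums J x"
proof (rule riesz_basis_bounds[OF riesz])
  assume "x \<in> X" and "\<And>c. summable (\<lambda>n. (cmod (c n))\<^sup>2) \<Longrightarrow> summable (\<lambda>n. c n *\<^sub>C e n)"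
  then show ?thesis unfolding ell2_diff_iff Hk_series_def by (intro summable_sums)
qed

lemma J_lincomb:
  assumes "x \<in> X" "y \<in> X"
  shows "J (\<lambda>n. \<alpha> * x n + y n) = \<alpha> *\<^sub>C J x + J y"
proof -
  have "(\<lambda>n. \<alpha> *\<^sub>C ((diff_op ^^ k) x n *\<^sub>C e n) + (diff_op ^^ k) y n *\<^sub>C e n) sums (\<alpha> *\<^sub>C J x + J y)"
    by (intro sums_add bounded_linear.sums[OF bounded_linear_scaleC_right] J_sums assms)
  then show ?thesis
    using J_sums[OF ell2_diff_lincomb[OF assms, of \<alpha>]]
    by (simp add: funpow_diff_op_lincomb scaleC_add_left scaleC_scaleC sums_unique2)
qed

lemma J_surj: "\<exists>x\<in>X. J x = h"
proof -
  obtain c where c: "summable (\<lambda>n. (cmod (c n))\<^sup>2)" "(\<lambda>n. c n *\<^sub>C e n) sums h"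
  proof (rule riesz_basis_bounds[OF riesz])
    assume "\<And>x. \<exists>c. summable (\<lambda>n. (cmod (c n))\<^sup>2) \<and> (\<lambda>n. c n *\<^sub>C e n) sums x"
    then show thesis using that by blast
  qed
  obtain x where "(diff_op ^^ k) x = c" using surj_funpow_diff_op by blast
  with c show ?thesis by (intro bexI[of _ x]) (simp_all add: ell2_diff_iff Hk_series_def sums_iff)
qed

text \<open>The lower Riesz bound makes the \<open>k\<close>-th difference of \<open>x - y\<close>
  vanish, and differences of any order are injective under the zero convention.\<close>

lemma J_inj:
  assumes "x \<in> X" "y \<in> X" "J x = J y"
  shows "x = y"
proof -
  define d where "d = (\<lambda>n. (-1) * y n + x n)"
  have d: "d \<in> X" unfolding d_def by (rule ell2_diff_lincomb[OF assms(2,1)])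
  have "J d = (-1) *\<^sub>C J y + 1 *\<^sub>C J y"
    using scaleC_of_real[of 1 "J y"] J_lincomb[OF assms(2,1), of "-1"] assms(3) by (simp add: d_def)
  then have Jd: "J d = 0" unfolding scaleC_add_left[symmetric] by simp
  obtain B where "(\<Sum>n. (cmod ((diff_op ^^ k) d n))\<^sup>2) \<le> B * (norm (J d))\<^sup>2"
  proof (rule riesz_basis_bounds[OF riesz])
    fix B
    assume "\<And>c. summable (\<lambda>n. (cmod (c n))\<^sup>2) \<Longrightarrow>
       (\<Sum>n. (cmod (c n))\<^sup>2) \<le> B * (norm (\<Sum>n. c n *\<^sub>C e n))\<^sup>2"
    then have "(\<Sum>n. (cmod ((diff_op ^^ k) d n))\<^sup>2) \<le> B * (norm (J d))\<^sup>2"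
      using d unfolding ell2_diff_iff Hk_series_def .
    then show thesis by (rule that)
  qed
  then have "(\<Sum>n. (cmod ((diff_op ^^ k) d n))\<^sup>2) = 0"
    using d Jd by (intro antisym suminf_nonneg) (simp_all add: ell2_diff_iff)
  then have "(diff_op ^^ k) d = (\<lambda>n. 0)"
    using d suminf_eq_zero_iff[of "\<lambda>n. (cmod ((diff_op ^^ k) d n))\<^sup>2"] by (auto simp: ell2_diff_iff)
  then have "(diff_op ^^ k) d = (diff_op ^^ k) (\<lambda>n. 0)" by (simp only: funpow_diff_op_zero)
  then have "d = (\<lambda>n. 0)" by (rule inj_funpow_diff_op)
  then show ?thesis by (auto simp: d_def fun_eq_iff)
qed

lemma Hk_inner_lincomb_left:
  "x \<in> X \<Longrightarrow> y \<in> X \<Longrightarrow> Hk_inner e k (\<lambda>n. \<alpha> * x n + y n) z = \<alpha> * Hk_inner e k x z + Hk_inner e k y z"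
  by (simp add: Hk_inner_def J_lincomb cinner_add_left cinner_scaleC_left)

lemma Hk_inner_lincomb_right:
  "x \<in> X \<Longrightarrow> y \<in> X \<Longrightarrow> Hk_inner e k z (\<lambda>n. \<alpha> * x n + y n) = cnj \<alpha> * Hk_inner e k z x + Hk_inner e k z y"
  by (simp add: Hk_inner_def J_lincomb cinner_add_right cinner_scaleC_right)

lemma Hk_inner_extensionality:
  assumes "x \<in> X" "y \<in> X" "\<And>u. u \<in> X \<Longrightarrow> Hk_inner e k u x = Hk_inner e k u y"
  shows "x = y"
proof (rule J_inj[OF assms(1,2)], rule cinner_extensionality)
  show "cinner u (J x) = cinner u (J y)" for u
    using J_surj[of u] assms(3) by (auto simp: Hk_inner_def)
qed

text \<open>Expansion along \<open>e\<close> reduces the question to the single coefficients, so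
  measurability is only ever asked of scalar functions.\<close>

lemma borel_measurable_cinner_J:
  assumes "\<And>s. c s \<in> X" "\<And>n. (\<lambda>s. c s n) \<in> borel_measurable M"
  shows "(\<lambda>s. cinner (J (c s)) h) \<in> borel_measurable M"
proof -
  have "cinner (J (c s)) h = (\<Sum>n. (diff_op ^^ k) (c s) n * cinner (e n) h)" for s
    using bounded_linear.sums[OF bounded_linear_cinner_left J_sums[OF assms(1)], of s h]
    by (simp add: cinner_scaleC_left sums_iff)
  moreover have "(\<lambda>s. \<Sum>n. (diff_op ^^ k) (c s) n * cinner (e n) h) \<in> borel_measurable M"
    using borel_measurable_funpow_diff_op[OF assms(2)] by measurable
  ultimately show ?thesis by simp
qed

lemma borel_measurable_Hk_norm_power2:
  assumes "\<And>s. c s \<in> X" "\<And>n. (\<lambda>s. c s n) \<in> borel_measurable M"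
  shows "(\<lambda>s. (Hk_norm e k (c s))\<^sup>2) \<in> borel_measurable M"
proof -
  obtain g :: "nat \<Rightarrow> 'h" where g: "orthonormal_basis g" using riesz by (auto simp: riesz_basis_def)
  have "(Hk_norm e k (c s))\<^sup>2 = (\<Sum>n. (cmod (cinner (J (c s)) (g n)))\<^sup>2)" for s
  proof -
    \<comment> \<open>The representation result serves as Parseval's identity here: for the
      functional given by \<open>J (c s)\<close> the representing vector is \<open>J (c s)\<close>
      itself. An orthonormal \<open>g\<close> is taken because \<open>e\<close> need not be
      orthonormal.\<close>
    obtain z where z: "\<And>x. cinner x z = cinner x (J (c s))"
      "norm z \<le> norm (J (c s))" "(\<lambda>n. (cmod (cinner (g n) (J (c s))))\<^sup>2) sums (norm z)\<^sup>2"
    proof (rule riesz_representation_basis[OF g, of "\<lambda>x. cinner x (J (c s))" "norm (J (c s))"])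
      show "cmod (cinner x (J (c s))) \<le> norm (J (c s)) * norm x" for x
        using cmod_cinner_le[of x "J (c s)"] by (simp add: mult.commute)
    qed (auto simp: cinner_add_left cinner_scaleC_left)
    have "z = J (c s)" by (rule cinner_extensionality) (rule z(1))
    moreover have "cmod (cinner (g n) (J (c s))) = cmod (cinner (J (c s)) (g n))" for n
      by (subst cinner_commute) simp
    ultimately show ?thesis using z(3) by (simp add: Hk_norm_def sums_iff)
  qed
  then show ?thesis using borel_measurable_cinner_J[OF assms] by simp
qed

end

locale resolvent_setting = Hk_space +
  fixes f :: "nat \<Rightarrow> real"
  assumes f: "f \<in> S_class k"
begin

definition R :: "complex \<Rightarrow> (nat \<Rightarrow> complex) \<Rightarrow> nat \<Rightarrow> complex" where
  "R \<mu> x = (\<lambda>n. resolvent_symbol f \<mu> n * x n)"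

lemma R_lincomb: "R \<mu> (\<lambda>n. \<alpha> * x n + y n) = (\<lambda>n. \<alpha> * R \<mu> x n + R \<mu> y n)"
  by (auto simp: R_def algebra_simps)

text \<open>Up to the factor 2, an upper bound for the square of
  \<open>1 + (1 / \<bar>Re \<mu>\<bar>) ^ k\<close>; it is constant along each vertical
  line.\<close>

definition weight :: "complex \<Rightarrow> real" where
  "weight \<mu> = 1 + (1 / \<bar>Re \<mu>\<bar>) ^ (2 * k)"

lemma weight_pos: "weight \<mu> > 0"
  by (simp add: weight_def add_pos_nonneg)

text \<open>Both halves spend the same pointwise domination, the first on the norm and the second on
  the pairing with a fixed \<open>y\<close>. In each, the sequence in the energy is fixed before
  \<open>\<mu>\<close>; in the second it does not depend on \<open>x\<close> either, so the estimate
  bounds a functional of \<open>x\<close>. A common \<open>K\<close> lets the halves be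
  combined.\<close>

lemma resolvent_estimates:
  shows "\<exists>K>0.
    (\<forall>x\<in>X. \<exists>q. (\<forall>n. q n \<ge> 0) \<and> summable q \<and> (\<Sum>n. q n) \<le> (Hk_norm e k x)\<^sup>2 \<and>
      (\<forall>\<mu>. Re \<mu> \<noteq> 0 \<longrightarrow> R \<mu> x \<in> X \<and>
        (Hk_norm e k (R \<mu> x))\<^sup>2 \<le> K * weight \<mu> * resolvent_energy f \<mu> q)) \<and>
    (\<forall>y. \<exists>p. (\<forall>n. p n \<ge> 0) \<and> summable p \<and> (\<Sum>n. p n) \<le> (norm y)\<^sup>2 \<and>
      (\<forall>\<mu>. Re \<mu> \<noteq> 0 \<longrightarrow> (\<forall>x\<in>X.
        (cmod (cinner (J (R \<mu> x)) y))\<^sup>2 \<le> K * weight \<mu> * resolvent_energy f \<mu> p * (Hk_norm e k x)\<^sup>2)))"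
proof -
  obtain B where B: "B > 0"
    "\<And>c. summable (\<lambda>n. (cmod (c n))\<^sup>2) \<Longrightarrow> summable (\<lambda>n. c n *\<^sub>C e n)"
    "\<And>c. summable (\<lambda>n. (cmod (c n))\<^sup>2) \<Longrightarrow>
       (norm (\<Sum>n. c n *\<^sub>C e n))\<^sup>2 \<le> B * (\<Sum>n. (cmod (c n))\<^sup>2)"
    "\<And>c. summable (\<lambda>n. (cmod (c n))\<^sup>2) \<Longrightarrow>
       (\<Sum>n. (cmod (c n))\<^sup>2) \<le> B * (norm (\<Sum>n. c n *\<^sub>C e n))\<^sup>2"
    "\<And>x. \<exists>c. summable (\<lambda>n. (cmod (c n))\<^sup>2) \<and> (\<lambda>n. c n *\<^sub>C e n) sums x"
    "\<And>y. summable (\<lambda>n. (cmod (cinner (e n) y))\<^sup>2)"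
    "\<And>y. (\<Sum>n. (cmod (cinner (e n) y))\<^sup>2) \<le> B * (norm y)\<^sup>2"
  proof (rule riesz_basis_bounds[OF riesz], goal_cases)
    case (1 B)
    from 1(2-) show thesis by (rule 1(1))
  qed
  obtain C where C: "C > 0" "\<forall>x\<in>X. \<exists>q. (\<forall>n. q n \<ge> 0) \<and> summable (\<lambda>n. (q n)\<^sup>2) \<and>
    (\<Sum>n. (q n)\<^sup>2) \<le> (\<Sum>n. (cmod ((diff_op ^^ k) x n))\<^sup>2) \<and>
    (\<forall>\<mu> n. Re \<mu> \<noteq> 0 \<longrightarrow> cmod ((diff_op ^^ k) (R \<mu> x) n)
       \<le> C * (1 + (1 / \<bar>Re \<mu>\<bar>) ^ k) * cmod (resolvent_symbol f \<mu> n) * q n)"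
    using resolvent_multiplier_bound[OF f] unfolding R_def by blast
  \<comment> \<open>One \<open>B\<close> converts between norms and coefficients and the other
    normalises the sequence inside the energy; \<open>2 * C^2\<close> comes from replacing the
    squared factor by \<open>weight\<close>.\<close>
  define K where "K = 2 * B\<^sup>2 * C\<^sup>2"
  have w: "(C * (1 + (1 / \<bar>Re \<mu>\<bar>) ^ k))\<^sup>2 \<le> 2 * C\<^sup>2 * weight \<mu>" for \<mu>
  proof -
    define v where "v = (1 / \<bar>Re \<mu>\<bar>) ^ k"
    have "(1 + v)\<^sup>2 \<le> 2 * (1 + v\<^sup>2)"
      using zero_le_power2[of "v - 1"] by (simp add: power2_eq_square algebra_simps)
    then have "C\<^sup>2 * (1 + v)\<^sup>2 \<le> C\<^sup>2 * (2 * (1 + v\<^sup>2))" by (rule mult_left_mono) simp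
    moreover have "weight \<mu> = 1 + v\<^sup>2"
      by (simp only: weight_def v_def power_mult[symmetric] mult.commute[of k])
    ultimately show ?thesis by (simp only: v_def[symmetric] power_mult_distrib mult_ac)
  qed
  have nJ: "(\<Sum>n. (cmod ((diff_op ^^ k) x n))\<^sup>2) \<le> B * (Hk_norm e k x)\<^sup>2" if "x \<in> X" for x
    using B(4) that by (simp add: ell2_diff_iff Hk_norm_def Hk_series_def)
  have E: "resolvent_energy f \<mu> (\<lambda>n. p n / B) = resolvent_energy f \<mu> p / B"
    if "\<And>n. p n \<ge> 0" "summable p" "Re \<mu> \<noteq> 0" for p \<mu>
    using suminf_divide[OF resolvent_energy_bounds(1)[OF that, of f], of B]
    by (simp add: resolvent_energy_def)
  show ?thesis
  proof (intro exI[of _ K] conjI ballI allI)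
    show "K > 0" using B C by (simp add: K_def)
  next
    fix x assume x: "x \<in> X"
    with C(2) obtain q where q: "\<And>n. q n \<ge> 0" "summable (\<lambda>n. (q n)\<^sup>2)"
      "(\<Sum>n. (q n)\<^sup>2) \<le> (\<Sum>n. (cmod ((diff_op ^^ k) x n))\<^sup>2)"
      "\<And>\<mu> n. Re \<mu> \<noteq> 0 \<Longrightarrow> cmod ((diff_op ^^ k) (R \<mu> x) n)
       \<le> C * (1 + (1 / \<bar>Re \<mu>\<bar>) ^ k) * cmod (resolvent_symbol f \<mu> n) * q n"
      by blast
    show "\<exists>q. (\<forall>n. q n \<ge> 0) \<and> summable q \<and> (\<Sum>n. q n) \<le> (Hk_norm e k x)\<^sup>2 \<and>
      (\<forall>\<mu>. Re \<mu> \<noteq> 0 \<longrightarrow> R \<mu> x \<in> X \<and>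
        (Hk_norm e k (R \<mu> x))\<^sup>2 \<le> K * weight \<mu> * resolvent_energy f \<mu> q)"
    proof (intro exI[of _ "\<lambda>n. (q n)\<^sup>2 / B"] conjI allI impI)
      show "0 \<le> (q n)\<^sup>2 / B" for n using B(1) by simp
      show "summable (\<lambda>n. (q n)\<^sup>2 / B)" by (rule summable_divide[OF q(2)])
      have "(\<Sum>n. (q n)\<^sup>2) \<le> B * (Hk_norm e k x)\<^sup>2" using q(3) nJ[OF x] by linarith
      then show "(\<Sum>n. (q n)\<^sup>2 / B) \<le> (Hk_norm e k x)\<^sup>2"
        using B(1) by (simp add: suminf_divide[OF q(2)] pos_divide_le_eq mult.commute)
    next
      fix \<mu> :: complex assume \<mu>: "Re \<mu> \<noteq> 0"
      let ?L = "C * (1 + (1 / \<bar>Re \<mu>\<bar>) ^ k)"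
      note en = resolvent_energy_bounds[OF zero_le_power2 q(2) \<mu>, of f]
      have le: "(cmod ((diff_op ^^ k) (R \<mu> x) n))\<^sup>2 \<le> ?L\<^sup>2 * ((cmod (resolvent_symbol f \<mu> n))\<^sup>2 * (q n)\<^sup>2)" for n
        using power_mono[OF q(4)[OF \<mu>, of n], of 2] by (simp add: power_mult_distrib mult.assoc)
      show Rx: "R \<mu> x \<in> X"
        unfolding ell2_diff_iff
        by (rule summable_comparison_test'[OF summable_mult[OF en(1), of "?L\<^sup>2"]]) (use le in auto)
      have "(Hk_norm e k (R \<mu> x))\<^sup>2 \<le> B * (\<Sum>n. (cmod ((diff_op ^^ k) (R \<mu> x) n))\<^sup>2)"
        using B(3) Rx by (simp add: ell2_diff_iff Hk_norm_def Hk_series_def)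
      also have "\<dots> \<le> B * (?L\<^sup>2 * resolvent_energy f \<mu> (\<lambda>n. (q n)\<^sup>2))"
        unfolding resolvent_energy_def suminf_mult[OF en(1), symmetric]
        using Rx B(1) by (intro mult_left_mono suminf_le le summable_mult en(1)) (simp_all add: ell2_diff_iff)
      also have "\<dots> \<le> B * (2 * C\<^sup>2 * weight \<mu> * resolvent_energy f \<mu> (\<lambda>n. (q n)\<^sup>2))"
        using B(1) en(2) by (intro mult_left_mono mult_right_mono w) simp_all
      also have "\<dots> = K * weight \<mu> * resolvent_energy f \<mu> (\<lambda>n. (q n)\<^sup>2 / B)"
        using B(1) by (simp add: E[OF zero_le_power2 q(2) \<mu>] K_def power2_eq_square[of B])
      finally show "(Hk_norm e k (R \<mu> x))\<^sup>2 \<le> K * weight \<mu> * resolvent_energy f \<mu> (\<lambda>n. (q n)\<^sup>2 / B)" .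
    qed
  next
    fix y :: 'a
    show "\<exists>p. (\<forall>n. p n \<ge> 0) \<and> summable p \<and> (\<Sum>n. p n) \<le> (norm y)\<^sup>2 \<and>
      (\<forall>\<mu>. Re \<mu> \<noteq> 0 \<longrightarrow> (\<forall>x\<in>X.
        (cmod (cinner (J (R \<mu> x)) y))\<^sup>2 \<le> K * weight \<mu> * resolvent_energy f \<mu> p * (Hk_norm e k x)\<^sup>2))"
    proof (intro exI[of _ "\<lambda>n. (cmod (cinner (e n) y))\<^sup>2 / B"] conjI allI impI ballI)
      show "0 \<le> (cmod (cinner (e n) y))\<^sup>2 / B" for n using B(1) by simp
      show "summable (\<lambda>n. (cmod (cinner (e n) y))\<^sup>2 / B)" by (rule summable_divide[OF B(6)])
      show "(\<Sum>n. (cmod (cinner (e n) y))\<^sup>2 / B) \<le> (norm y)\<^sup>2"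
        using B(1) B(7)[of y] by (simp add: suminf_divide[OF B(6)] pos_divide_le_eq mult.commute)
    next
      fix \<mu> :: complex and x assume \<mu>: "Re \<mu> \<noteq> 0" and x: "x \<in> X"
      from x C(2) obtain q where q: "\<And>n. q n \<ge> 0" "summable (\<lambda>n. (q n)\<^sup>2)"
        "(\<Sum>n. (q n)\<^sup>2) \<le> (\<Sum>n. (cmod ((diff_op ^^ k) x n))\<^sup>2)"
        "\<And>\<mu> n. Re \<mu> \<noteq> 0 \<Longrightarrow> cmod ((diff_op ^^ k) (R \<mu> x) n)
         \<le> C * (1 + (1 / \<bar>Re \<mu>\<bar>) ^ k) * cmod (resolvent_symbol f \<mu> n) * q n"
        by blast
      let ?L = "C * (1 + (1 / \<bar>Re \<mu>\<bar>) ^ k)"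
      let ?E = "resolvent_energy f \<mu> (\<lambda>n. (cmod (cinner (e n) y))\<^sup>2)"
      have L: "?L \<ge> 0" using C(1) by simp
      note en = resolvent_energy_bounds[OF zero_le_power2 B(6) \<mu>, of f y]
      \<comment> \<open>Grouping the symbol with the coefficients of \<open>y\<close> leaves
        \<open>q\<close>, which is free of \<open>\<mu>\<close>, as the other Cauchy-Schwarz factor;
        it is then bounded by the norm of \<open>x\<close>.\<close>
      define b where "b n = cmod (resolvent_symbol f \<mu> n) * cmod (cinner (e n) y)" for n
      have b: "(\<Sum>n. (b n)\<^sup>2) = ?E" "summable (\<lambda>n. (b n)\<^sup>2)" "\<And>n. b n \<ge> 0"
        using en(1) by (simp_all add: b_def power_mult_distrib resolvent_energy_def)
      note cs = cauchy_schwarz_suminf[OF q(1) b(3) q(2) b(2)]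
      have "R \<mu> x \<in> X"
        unfolding ell2_diff_iff
      proof (rule summable_comparison_test'[OF summable_mult[OF
              resolvent_energy_bounds(1)[OF zero_le_power2 q(2) \<mu>, of f], of "?L\<^sup>2"]])
        show "norm ((cmod ((diff_op ^^ k) (R \<mu> x) n))\<^sup>2)
            \<le> ?L\<^sup>2 * ((cmod (resolvent_symbol f \<mu> n))\<^sup>2 * (q n)\<^sup>2)" for n
          using power_mono[OF q(4)[OF \<mu>, of n], of 2] by (simp add: power_mult_distrib mult.assoc)
      qed
      then have s: "(\<lambda>n. (diff_op ^^ k) (R \<mu> x) n * cinner (e n) y) sums cinner (J (R \<mu> x)) y"
        using bounded_linear.sums[OF bounded_linear_cinner_left J_sums] by (simp add: cinner_scaleC_left)
      have le: "cmod ((diff_op ^^ k) (R \<mu> x) n * cinner (e n) y) \<le> ?L * (q n * b n)" for n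
        using mult_right_mono[OF q(4)[OF \<mu>, of n], of "cmod (cinner (e n) y)"]
        by (simp add: norm_mult b_def mult_ac)
      have "cmod (cinner (J (R \<mu> x)) y) \<le> (\<Sum>n. ?L * (q n * b n))"
        unfolding sums_unique[OF s] by (rule norm_suminf_le[OF le summable_mult[OF cs(1)]])
      then have "cmod (cinner (J (R \<mu> x)) y) \<le> ?L * (\<Sum>n. q n * b n)"
        by (simp only: suminf_mult[OF cs(1)])
      then have "(cmod (cinner (J (R \<mu> x)) y))\<^sup>2 \<le> (?L * (\<Sum>n. q n * b n))\<^sup>2"
        by (rule power_mono) simp
      also have "\<dots> = ?L\<^sup>2 * (\<Sum>n. q n * b n)\<^sup>2" by (rule power_mult_distrib)
      also have "\<dots> \<le> (2 * C\<^sup>2 * weight \<mu>) * (B * (Hk_norm e k x)\<^sup>2 * ?E)"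
      proof (rule mult_mono[OF w])
        have "(\<Sum>n. q n * b n)\<^sup>2 \<le> (\<Sum>n. (q n)\<^sup>2) * ?E" using cs(2) by (simp only: b)
        also have "\<dots> \<le> B * (Hk_norm e k x)\<^sup>2 * ?E"
          using q(3) nJ[OF x] en(2) by (intro mult_right_mono) linarith+
        finally show "(\<Sum>n. q n * b n)\<^sup>2 \<le> B * (Hk_norm e k x)\<^sup>2 * ?E" .
      qed (use weight_pos[of \<mu>] in simp_all)
      also have "\<dots> = K * weight \<mu> * resolvent_energy f \<mu> (\<lambda>n. (cmod (cinner (e n) y))\<^sup>2 / B) * (Hk_norm e k x)\<^sup>2"
        using B(1) by (simp add: E[OF zero_le_power2 B(6) \<mu>] K_def power2_eq_square[of B])
      finally show "(cmod (cinner (J (R \<mu> x)) y))\<^sup>2 \<le> K * weight \<mu> *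
          resolvent_energy f \<mu> (\<lambda>n. (cmod (cinner (e n) y))\<^sup>2 / B) * (Hk_norm e k x)\<^sup>2" .
    qed
  qed
qed

end

section \<open>The resolvents of the operator and of its adjoint\<close>

lemma op_shiftI: "(x, v) \<in> T \<Longrightarrow> (x, \<lambda>n. v n + \<mu> * x n) \<in> op_shift T \<mu>"
  by (auto simp: op_shift_def)

context resolvent_setting
begin

section \<open>The resolvent of the operator and its norm\<close>

lemma R_in: "Re \<mu> \<noteq> 0 \<Longrightarrow> x \<in> X \<Longrightarrow> R \<mu> x \<in> X"
  using resolvent_estimates by blast

text \<open>Solving \<open>(\<i> f + \<mu>) R x = x\<close> for \<open>f R x\<close> gives a
  combination of \<open>x\<close> and \<open>R \<mu> x\<close>, both in the space; this is what puts
  \<open>R \<mu> x\<close> into the domain.\<close>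

lemma f_times_R:
  assumes "Re \<mu> \<noteq> 0"
  shows "complex_of_real (f n) * R \<mu> x n = (- \<i>) * x n + \<i> * \<mu> * R \<mu> x n"
proof -
  have "(\<i> * complex_of_real (f n) + \<mu>) * R \<mu> x n = x n"
    using resolvent_symbol_denom_nz[OF assms] by (simp add: R_def resolvent_symbol_def)
  then have "x n - \<mu> * R \<mu> x n = \<i> * (complex_of_real (f n) * R \<mu> x n)"
    by (simp add: algebra_simps)
  then have "(- \<i>) * (x n - \<mu> * R \<mu> x n) = complex_of_real (f n) * R \<mu> x n"
    by (simp add: mult.assoc[symmetric])
  then show ?thesis by (simp add: algebra_simps)
qed

lemma R_in_domain:
  assumes "Re \<mu> \<noteq> 0" "x \<in> X"
  shows "(R \<mu> x, \<lambda>n. \<i> * complex_of_real (f n) * R \<mu> x n) \<in> A_op f k"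
    and "(\<lambda>n. \<i> * complex_of_real (f n) * R \<mu> x n + \<mu> * R \<mu> x n) = x"
proof -
  have "(\<lambda>n. complex_of_real (f n) * R \<mu> x n) = (\<lambda>n. (- \<i>) * x n + (\<i> * \<mu> * R \<mu> x n + 0))"
    using f_times_R[OF assms(1)] by simp
  also have "\<dots> \<in> X"
    by (intro ell2_diff_lincomb assms R_in zero_in_ell2_diff)
  finally show "(R \<mu> x, \<lambda>n. \<i> * complex_of_real (f n) * R \<mu> x n) \<in> A_op f k"
    using R_in[OF assms] by (auto simp: A_op_def)
  show "(\<lambda>n. \<i> * complex_of_real (f n) * R \<mu> x n + \<mu> * R \<mu> x n) = x"
    by (simp add: mult.assoc f_times_R[OF assms(1)]) (simp add: algebra_simps flip: mult.assoc)
qed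

lemma R_left_inverse:
  assumes "Re \<mu> \<noteq> 0"
  shows "R \<mu> (\<lambda>n. \<i> * complex_of_real (f n) * x n + \<mu> * x n) = x"
  using resolvent_symbol_denom_nz[OF assms]
  by (simp add: R_def resolvent_symbol_def distrib_right[symmetric])

lemma A_op_in: "(x, v) \<in> A_op f k \<Longrightarrow> x \<in> X \<and> v \<in> X \<and> v = (\<lambda>n. \<i> * complex_of_real (f n) * x n)"
  using ell2_diff_lincomb[OF _ zero_in_ell2_diff, of "\<lambda>n. complex_of_real (f n) * x n" k \<i>]
  by (auto simp: A_op_def mult.assoc)

text \<open>The two inclusions are the two halves of invertibility: the multiplier undoes the
  shifted operator on its domain, and it maps the whole space into that domain as a right
  inverse.\<close>

lemma converse_op_shift_A_op:
  assumes "Re \<mu> \<noteq> 0"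
  shows "(op_shift (A_op f k) \<mu>)\<inverse> = {(x, R \<mu> x) |x. x \<in> X}"
proof (intro equalityI subrelI)
  fix y x assume "(y, x) \<in> (op_shift (A_op f k) \<mu>)\<inverse>"
  then obtain v where v: "(x, v) \<in> A_op f k" "y = (\<lambda>n. v n + \<mu> * x n)"
    by (auto simp: op_shift_def)
  note Av = A_op_in[OF v(1)]
  have "y = (\<lambda>n. \<mu> * x n + v n)" using v(2) by auto
  then have "y \<in> X" using Av ell2_diff_lincomb[of x k v \<mu>] by metis
  moreover have "R \<mu> y = x"
    using R_left_inverse[OF assms, of x] Av v(2) by simp
  ultimately show "(y, x) \<in> {(x, R \<mu> x) |x. x \<in> X}" by auto
next
  fix y x assume "(y, x) \<in> {(x, R \<mu> x) |x. x \<in> X}"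
  then have y: "y \<in> X" "x = R \<mu> y" by auto
  show "(y, x) \<in> (op_shift (A_op f k) \<mu>)\<inverse>"
    using op_shiftI[OF R_in_domain(1)[OF assms y(1)], of \<mu>]
    unfolding R_in_domain(2)[OF assms y(1)] y(2) by simp
qed

lemma relpow2_graph:
  assumes "Re \<mu> \<noteq> 0" "x \<in> X"
  shows "op_app ((op_shift (A_op f k) \<mu>)\<inverse> ^^ 2) x = R \<mu> (R \<mu> x)"
proof -
  have "(op_shift (A_op f k) \<mu>)\<inverse> ^^ 2 = {(x, R \<mu> (R \<mu> x)) |x. x \<in> X}"
    unfolding converse_op_shift_A_op[OF assms(1)] numeral_2_eq_2
    using R_in[OF assms(1)] by (auto simp: relcomp_unfold)
  then show ?thesis using assms(2) op_app_graph[of x X "\<lambda>x. R \<mu> (R \<mu> x)"] by simp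
qed

text \<open>With the remaining symbol in the energy now also bounded by
  \<open>u = 1 / \<bar>Re \<mu>\<bar>\<close>, and \<open>weight\<close> by
  \<open>(1 + u ^ k)^2\<close>, the squared estimate becomes a perfect square.\<close>

lemma Hk_norm_R_le:
  "\<exists>N>0. \<forall>\<mu>. Re \<mu> \<noteq> 0 \<longrightarrow> (\<forall>x\<in>X.
     Hk_norm e k (R \<mu> x) \<le> N * ((1 + (1 / \<bar>Re \<mu>\<bar>) ^ k) * (1 / \<bar>Re \<mu>\<bar>)) * Hk_norm e k x)"
proof -
  obtain K where K: "K > 0" "\<forall>x\<in>X. \<exists>q. (\<forall>n. q n \<ge> 0) \<and> summable q \<and> (\<Sum>n. q n) \<le> (Hk_norm e k x)\<^sup>2 \<and>
      (\<forall>\<mu>. Re \<mu> \<noteq> 0 \<longrightarrow> R \<mu> x \<in> X \<and>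
        (Hk_norm e k (R \<mu> x))\<^sup>2 \<le> K * weight \<mu> * resolvent_energy f \<mu> q)"
    using resolvent_estimates by blast
  show ?thesis
  proof (intro exI[of _ "sqrt K"] conjI allI impI ballI)
    show "sqrt K > 0" using K by simp
    fix \<mu> :: complex and x assume \<mu>: "Re \<mu> \<noteq> 0" and x: "x \<in> X"
    define u where "u = 1 / \<bar>Re \<mu>\<bar>"
    have u: "u \<ge> 0" by (simp add: u_def)
    obtain q where q: "\<And>n. q n \<ge> 0" "summable q" "(\<Sum>n. q n) \<le> (Hk_norm e k x)\<^sup>2"
      "(Hk_norm e k (R \<mu> x))\<^sup>2 \<le> K * weight \<mu> * resolvent_energy f \<mu> q"
      using K(2) x \<mu> by blast
    have w: "weight \<mu> \<le> (1 + u ^ k)\<^sup>2"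
    proof -
      have "u ^ (2 * k) = (u ^ k)\<^sup>2" by (simp only: power_mult[symmetric] mult.commute)
      moreover have "(1 + u ^ k)\<^sup>2 = 1 + (u ^ k)\<^sup>2 + 2 * u ^ k" by (simp add: power2_eq_square algebra_simps)
      ultimately show ?thesis using u by (simp add: weight_def u_def[symmetric])
    qed
    have "resolvent_energy f \<mu> q \<le> u\<^sup>2 * (\<Sum>n. q n)"
      unfolding u_def by (rule resolvent_energy_bounds(3)[OF q(1,2) \<mu>])
    also have "\<dots> \<le> u\<^sup>2 * (Hk_norm e k x)\<^sup>2" by (rule mult_left_mono[OF q(3)]) simp
    finally have E: "resolvent_energy f \<mu> q \<le> u\<^sup>2 * (Hk_norm e k x)\<^sup>2" .
    note q(4)
    also have "K * weight \<mu> * resolvent_energy f \<mu> q \<le> K * (1 + u ^ k)\<^sup>2 * (u\<^sup>2 * (Hk_norm e k x)\<^sup>2)"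
      using K(1) w E resolvent_energy_bounds(2)[OF q(1,2) \<mu>, of f] weight_pos[of \<mu>]
      by (intro mult_mono) auto
    also have "\<dots> = (sqrt K * ((1 + u ^ k) * u) * Hk_norm e k x)\<^sup>2"
      using K(1) by (simp add: power_mult_distrib)
    finally show "Hk_norm e k (R \<mu> x) \<le> sqrt K * ((1 + (1 / \<bar>Re \<mu>\<bar>) ^ k) * (1 / \<bar>Re \<mu>\<bar>)) * Hk_norm e k x"
      unfolding u_def[symmetric]
      by (rule power2_le_imp_le) (use K(1) u in \<open>simp add: Hk_norm_def\<close>)
  qed
qed

lemma bounded_resolvent:
  assumes "Re \<mu> \<noteq> 0"
  shows "Hk_bounded_op e k ((op_shift (A_op f k) \<mu>)\<inverse>)"
proof -
  obtain N where "\<And>x. x \<in> X \<Longrightarrow> Hk_norm e k (R \<mu> x) \<le> N * Hk_norm e k x"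
    using Hk_norm_R_le assms by blast
  then show ?thesis
    unfolding converse_op_shift_A_op[OF assms]
    by (intro Hk_bounded_op_graph R_in[OF assms] R_lincomb)
qed

lemma resolvent_norm_estimate:
  "\<forall>a>0. \<exists>C>0.
        (\<forall>l. 0 < \<bar>Re l\<bar> \<and> \<bar>Re l\<bar> < a \<longrightarrow>
           Hk_bounded_op e k ((op_shift (A_op f k) (- l))\<inverse>) \<and>
           Hk_opnorm e k ((op_shift (A_op f k) (- l))\<inverse>) \<le> C / \<bar>Re l\<bar> ^ (k + 1)) \<and>
        (\<forall>l. \<bar>Re l\<bar> \<ge> a \<longrightarrow>
           Hk_bounded_op e k ((op_shift (A_op f k) (- l))\<inverse>) \<and>
           Hk_opnorm e k ((op_shift (A_op f k) (- l))\<inverse>) \<le> C)"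
proof (intro allI impI)
  fix a :: real assume a: "a > 0"
  obtain N where N: "N > 0" "\<And>\<mu> x. Re \<mu> \<noteq> 0 \<Longrightarrow> x \<in> X \<Longrightarrow>
     Hk_norm e k (R \<mu> x) \<le> N * ((1 + (1 / \<bar>Re \<mu>\<bar>) ^ k) * (1 / \<bar>Re \<mu>\<bar>)) * Hk_norm e k x"
    using Hk_norm_R_le by blast
  have op: "Hk_opnorm e k ((op_shift (A_op f k) (- l))\<inverse>) \<le> N * ((1 + (1 / \<bar>Re l\<bar>) ^ k) * (1 / \<bar>Re l\<bar>))"
    if "\<bar>Re l\<bar> > 0" for l
  proof -
    have l: "Re (- l) \<noteq> 0" using that by simp
    show ?thesis
      unfolding converse_op_shift_A_op[OF l]
      using N(1) N(2)[OF l] by (intro Hk_opnorm_graph_le) simp_all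
  qed
  have bd: "Hk_bounded_op e k ((op_shift (A_op f k) (- l))\<inverse>)" if "\<bar>Re l\<bar> > 0" for l
    by (rule bounded_resolvent) (use that in simp)
  \<comment> \<open>The first summand serves the strip, where
    \<open>(1 + u ^ k) * u = (1 + r ^ k) / r ^ (k + 1)\<close> and \<open>r < a\<close>; the second
    serves \<open>r \<ge> a\<close>, where \<open>u \<le> 1 / a\<close>.\<close>
  define C where "C = N * (1 + a ^ k) + N * ((1 + (1 / a) ^ k) * (1 / a))"
  have C: "N * (1 + a ^ k) > 0" "N * ((1 + (1 / a) ^ k) * (1 / a)) > 0"
    using N(1) a by (simp_all add: zero_less_mult_iff add_pos_nonneg)
  show "\<exists>C>0.
        (\<forall>l. 0 < \<bar>Re l\<bar> \<and> \<bar>Re l\<bar> < a \<longrightarrow>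
           Hk_bounded_op e k ((op_shift (A_op f k) (- l))\<inverse>) \<and>
           Hk_opnorm e k ((op_shift (A_op f k) (- l))\<inverse>) \<le> C / \<bar>Re l\<bar> ^ (k + 1)) \<and>
        (\<forall>l. \<bar>Re l\<bar> \<ge> a \<longrightarrow>
           Hk_bounded_op e k ((op_shift (A_op f k) (- l))\<inverse>) \<and>
           Hk_opnorm e k ((op_shift (A_op f k) (- l))\<inverse>) \<le> C)"
  proof (intro exI[of _ C] conjI allI impI; (elim conjE)?)
    show "C > 0" using C by (simp add: C_def)
  next
    fix l :: complex assume l: "0 < \<bar>Re l\<bar>" "\<bar>Re l\<bar> < a"
    show "Hk_bounded_op e k ((op_shift (A_op f k) (- l))\<inverse>)" by (rule bd[OF l(1)])
    let ?r = "\<bar>Re l\<bar>"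
    have "N * ((1 + (1 / ?r) ^ k) * (1 / ?r)) = N * (1 + ?r ^ k) / ?r ^ (k + 1)"
    proof -
      have "(1 + (1 / r) ^ k) * (1 / r) = (1 + r ^ k) / r ^ (k + 1)" if "r > 0" for r :: real
        using that by (simp add: field_simps)
      then show ?thesis using l(1) by simp
    qed
    also have "\<dots> \<le> C / ?r ^ (k + 1)"
    proof (rule divide_right_mono)
      have "N * (1 + ?r ^ k) \<le> N * (1 + a ^ k)"
        using N(1) l by (intro mult_left_mono add_left_mono power_mono) simp_all
      then show "N * (1 + ?r ^ k) \<le> C" using C by (simp add: C_def)
    qed simp
    finally show "Hk_opnorm e k ((op_shift (A_op f k) (- l))\<inverse>) \<le> C / ?r ^ (k + 1)"
      using op[OF l(1)] by linarith
  next
    fix l :: complex assume l: "a \<le> \<bar>Re l\<bar>"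
    show "Hk_bounded_op e k ((op_shift (A_op f k) (- l))\<inverse>)" by (rule bd) (use l a in linarith)
    have "1 / \<bar>Re l\<bar> \<le> 1 / a" using l a by (simp add: frac_le)
    then have "N * ((1 + (1 / \<bar>Re l\<bar>) ^ k) * (1 / \<bar>Re l\<bar>)) \<le> N * ((1 + (1 / a) ^ k) * (1 / a))"
      using N(1) a by (intro mult_left_mono mult_mono add_left_mono power_mono) simp_all
    also have "\<dots> \<le> C" using C by (simp add: C_def)
    finally show "Hk_opnorm e k ((op_shift (A_op f k) (- l))\<inverse>) \<le> C"
      using op[of l] l a by linarith
  qed
qed

section \<open>The resolvent of the adjoint, described by duality\<close>

definition adj_vec :: "complex \<Rightarrow> (nat \<Rightarrow> complex) \<Rightarrow> nat \<Rightarrow> complex" where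
  "adj_vec \<mu> y = (THE z. z \<in> X \<and> (\<forall>u\<in>X. Hk_inner e k u z = Hk_inner e k (R (cnj \<mu>) u) y))"

text \<open>Riesz representation of the functional
  \<open>u \<mapsto> Hk_inner e k (R (cnj \<mu>) u) y\<close>, carried out after transport by
  \<open>J\<close>. Any bound \<open>N\<close> of the functional bounds the norm, so sharper bounds
  depending on \<open>\<mu>\<close> can be inserted later, and the last conclusion yields
  measurability in \<open>\<mu>\<close>.\<close>

lemma adj_vec_properties:
  assumes \<mu>: "Re \<mu> \<noteq> 0" and y: "y \<in> X" and g: "orthonormal_basis g"
    and G: "\<And>n. G n \<in> X" "\<And>n. J (G n) = g n"
    and N: "\<And>u. u \<in> X \<Longrightarrow> cmod (cinner (J (R (cnj \<mu>) u)) (J y)) \<le> N * Hk_norm e k u" "N \<ge> 0"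
  shows "adj_vec \<mu> y \<in> X"
    and "u \<in> X \<Longrightarrow> Hk_inner e k u (adj_vec \<mu> y) = Hk_inner e k (R (cnj \<mu>) u) y"
    and "Hk_norm e k (adj_vec \<mu> y) \<le> N"
    and "(\<lambda>n. (cmod (cinner (J (R (cnj \<mu>) (G n))) (J y)))\<^sup>2) sums (Hk_norm e k (adj_vec \<mu> y))\<^sup>2"
proof -
  have \<mu>': "Re (cnj \<mu>) \<noteq> 0" using \<mu> by simp
  \<comment> \<open>The inverse of \<open>J\<close>; its linearity follows from injectivity and is
    what makes \<open>\<phi>\<close> linear.\<close>
  define I where "I h = (SOME x. x \<in> X \<and> J x = h)" for h
  have I: "I h \<in> X" "J (I h) = h" for h
    using someI_ex[of "\<lambda>x. x \<in> X \<and> J x = h"] J_surj[of h] by (auto simp: I_def)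
  have IJ: "I (J u) = u" if "u \<in> X" for u using J_inj[OF I(1) that] I(2) by simp
  define \<phi> where "\<phi> h = cinner (J (R (cnj \<mu>) (I h))) (J y)" for h
  have I_lin: "I (\<alpha> *\<^sub>C h + h') = (\<lambda>n. \<alpha> * I h n + I h' n)" for \<alpha> h h'
    by (rule J_inj) (simp_all add: I ell2_diff_lincomb J_lincomb)
  have \<phi>_lin: "\<phi> (\<alpha> *\<^sub>C h + h') = \<alpha> * \<phi> h + \<phi> h'" for \<alpha> h h'
    unfolding \<phi>_def I_lin R_lincomb
    by (simp add: J_lincomb R_in \<mu> I cinner_add_left cinner_scaleC_left)
  have one: "1 *\<^sub>C h = h" for h :: 'a using scaleC_of_real[of 1 h] by simp
  have \<phi>0: "\<phi> 0 = 0" using \<phi>_lin[of 1 0 0] by (simp add: one)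
  obtain z where z: "\<And>h. cinner h z = \<phi> h" "norm z \<le> N" "(\<lambda>n. (cmod (\<phi> (g n)))\<^sup>2) sums (norm z)\<^sup>2"
  proof (rule riesz_representation_basis[OF g, of \<phi> N])
    show "\<phi> (h + h') = \<phi> h + \<phi> h'" for h h' using \<phi>_lin[of 1 h h'] by (simp add: one)
    show "\<phi> (\<alpha> *\<^sub>C h) = \<alpha> * \<phi> h" for \<alpha> h using \<phi>_lin[of \<alpha> h 0] by (simp add: \<phi>0)
    show "cmod (\<phi> h) \<le> N * norm h" for h
      using N(1)[OF I(1)[of h]] by (simp add: \<phi>_def Hk_norm_def I)
  qed (use N in auto)
  have P: "I z \<in> X \<and> (\<forall>u\<in>X. Hk_inner e k u (I z) = Hk_inner e k (R (cnj \<mu>) u) y)"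
    using z(1) by (simp add: Hk_inner_def I \<phi>_def IJ)
  have "adj_vec \<mu> y = I z"
    unfolding adj_vec_def
  proof (rule the_equality)
    show "I z \<in> X \<and> (\<forall>u\<in>X. Hk_inner e k u (I z) = Hk_inner e k (R (cnj \<mu>) u) y)" by (rule P)
    fix z' assume "z' \<in> X \<and> (\<forall>u\<in>X. Hk_inner e k u z' = Hk_inner e k (R (cnj \<mu>) u) y)"
    with P show "z' = I z" by (intro Hk_inner_extensionality) auto
  qed
  with P show "adj_vec \<mu> y \<in> X" "u \<in> X \<Longrightarrow> Hk_inner e k u (adj_vec \<mu> y) = Hk_inner e k (R (cnj \<mu>) u) y"
    by auto
  have "Hk_norm e k (adj_vec \<mu> y) = norm z" by (simp add: \<open>adj_vec \<mu> y = I z\<close> Hk_norm_def I)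
  moreover have "\<phi> (g n) = cinner (J (R (cnj \<mu>) (G n))) (J y)" for n
    by (simp add: \<phi>_def G(2)[symmetric] IJ G(1))
  ultimately show "Hk_norm e k (adj_vec \<mu> y) \<le> N"
    "(\<lambda>n. (cmod (cinner (J (R (cnj \<mu>) (G n))) (J y)))\<^sup>2) sums (Hk_norm e k (adj_vec \<mu> y))\<^sup>2"
    using z by simp_all
qed

lemma orthonormal_coordinates:
  "\<exists>g G. orthonormal_basis (g :: nat \<Rightarrow> 'a) \<and> (\<forall>n. G n \<in> X) \<and> (\<forall>n. J (G n) = g n)"
proof -
  obtain g :: "nat \<Rightarrow> 'a" where g: "orthonormal_basis g" using riesz by (auto simp: riesz_basis_def)
  have "\<forall>n. \<exists>x. x \<in> X \<and> J x = g n" using J_surj by blast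
  then obtain G where "\<And>n. G n \<in> X \<and> J (G n) = g n" by metis
  with g show ?thesis by blast
qed

lemma adj_vec_bound:
  "\<exists>N>0. \<forall>\<mu>. Re \<mu> \<noteq> 0 \<longrightarrow> (\<forall>y\<in>X. \<forall>u\<in>X.
     cmod (cinner (J (R (cnj \<mu>) u)) (J y)) \<le> (N * ((1 + (1 / \<bar>Re \<mu>\<bar>) ^ k) * (1 / \<bar>Re \<mu>\<bar>)) * Hk_norm e k y) * Hk_norm e k u)"
proof -
  obtain N where N: "N > 0" "\<And>\<mu> x. Re \<mu> \<noteq> 0 \<Longrightarrow> x \<in> X \<Longrightarrow>
     Hk_norm e k (R \<mu> x) \<le> N * ((1 + (1 / \<bar>Re \<mu>\<bar>) ^ k) * (1 / \<bar>Re \<mu>\<bar>)) * Hk_norm e k x"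
    using Hk_norm_R_le by blast
  show ?thesis
  proof (intro exI[of _ N] conjI allI impI ballI N(1))
    fix \<mu> :: complex and y u assume \<mu>: "Re \<mu> \<noteq> 0" and "y \<in> X" "u \<in> X"
    have "cmod (cinner (J (R (cnj \<mu>) u)) (J y)) \<le> Hk_norm e k (R (cnj \<mu>) u) * Hk_norm e k y"
      unfolding Hk_norm_def by (rule cmod_cinner_le)
    also have "\<dots> \<le> (N * ((1 + (1 / \<bar>Re \<mu>\<bar>) ^ k) * (1 / \<bar>Re \<mu>\<bar>)) * Hk_norm e k u) * Hk_norm e k y"
      using N(2)[of "cnj \<mu>" u] \<mu> \<open>u \<in> X\<close> by (intro mult_right_mono) (simp_all add: Hk_norm_def)
    finally show "cmod (cinner (J (R (cnj \<mu>) u)) (J y))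
      \<le> (N * ((1 + (1 / \<bar>Re \<mu>\<bar>) ^ k) * (1 / \<bar>Re \<mu>\<bar>)) * Hk_norm e k y) * Hk_norm e k u"
      by (simp only: mult_ac)
  qed
qed

lemma adj_vec:
  assumes \<mu>: "Re \<mu> \<noteq> 0" and y: "y \<in> X"
  shows adj_vec_in: "adj_vec \<mu> y \<in> X"
    and Hk_inner_adj_vec: "u \<in> X \<Longrightarrow> Hk_inner e k u (adj_vec \<mu> y) = Hk_inner e k (R (cnj \<mu>) u) y"
proof -
  obtain g G where g: "orthonormal_basis (g :: nat \<Rightarrow> 'a)" "\<And>n. G n \<in> X" "\<And>n. J (G n) = g n"
    using orthonormal_coordinates by blast
  obtain N where N: "N > 0" "\<And>u. u \<in> X \<Longrightarrow> cmod (cinner (J (R (cnj \<mu>) u)) (J y)) \<le>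
     (N * ((1 + (1 / \<bar>Re \<mu>\<bar>) ^ k) * (1 / \<bar>Re \<mu>\<bar>)) * Hk_norm e k y) * Hk_norm e k u"
    using adj_vec_bound \<mu> y by blast
  have "0 \<le> N * ((1 + (1 / \<bar>Re \<mu>\<bar>) ^ k) * (1 / \<bar>Re \<mu>\<bar>)) * Hk_norm e k y"
    using N(1) by (simp add: Hk_norm_def)
  note P = adj_vec_properties[OF \<mu> y g N(2) this]
  show "adj_vec \<mu> y \<in> X" by (rule P(1))
  show "u \<in> X \<Longrightarrow> Hk_inner e k u (adj_vec \<mu> y) = Hk_inner e k (R (cnj \<mu>) u) y" by (rule P(2))
qed

lemma adj_vec_eqI:
  assumes "Re \<mu> \<noteq> 0" "y \<in> X" "z \<in> X" "\<And>u. u \<in> X \<Longrightarrow> Hk_inner e k u z = Hk_inner e k (R (cnj \<mu>) u) y"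
  shows "adj_vec \<mu> y = z"
  using assms by (intro Hk_inner_extensionality) (simp_all add: adj_vec_in Hk_inner_adj_vec)

text \<open>The inverse of \<open>A* + \<mu>\<close> is the adjoint of the inverse of
  \<open>A + cnj \<mu>\<close>. Testing against the graph of \<open>A\<close> and testing against
  all \<open>u\<close> in the space are equivalent, because every \<open>u\<close> is
  \<open>v + cnj \<mu> * x\<close> for exactly one \<open>(x, v)\<close> in the graph.\<close>

lemma converse_op_shift_adjoint:
  assumes \<mu>: "Re \<mu> \<noteq> 0"
  shows "(op_shift (Hk_adjoint e k (A_op f k)) \<mu>)\<inverse> = {(y, adj_vec \<mu> y) |y. y \<in> X}"
proof (intro equalityI subrelI)
  have \<mu>': "Re (cnj \<mu>) \<noteq> 0" using \<mu> by simp
  fix y z assume "(y, z) \<in> (op_shift (Hk_adjoint e k (A_op f k)) \<mu>)\<inverse>"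
  then obtain w where w: "(z, w) \<in> Hk_adjoint e k (A_op f k)" and y_eq: "y = (\<lambda>n. w n + \<mu> * z n)"
    by (auto simp: op_shift_def)
  from w have zw: "z \<in> X" "w \<in> X" "\<And>x v. (x, v) \<in> A_op f k \<Longrightarrow> Hk_inner e k v z = Hk_inner e k x w"
    by (auto simp: Hk_adjoint_def)
  have y_eq': "y = (\<lambda>n. \<mu> * z n + w n)" using y_eq by auto
  then have y: "y \<in> X" using zw by (simp add: ell2_diff_lincomb)
  have "adj_vec \<mu> y = z"
  proof (rule adj_vec_eqI[OF \<mu> y zw(1)])
    fix u assume u: "u \<in> X"
    let ?x = "R (cnj \<mu>) u" and ?v = "\<lambda>n. \<i> * complex_of_real (f n) * R (cnj \<mu>) u n"
    have xv: "(?x, ?v) \<in> A_op f k" and u_eq: "(\<lambda>n. ?v n + cnj \<mu> * ?x n) = u"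
      using R_in_domain[OF \<mu>' u] by auto
    have "u = (\<lambda>n. cnj \<mu> * ?x n + ?v n)" using u_eq by (auto simp: fun_eq_iff add.commute)
    then have "Hk_inner e k u z = Hk_inner e k (\<lambda>n. cnj \<mu> * ?x n + ?v n) z" by simp
    also have "\<dots> = cnj \<mu> * Hk_inner e k ?x z + Hk_inner e k ?v z"
      using A_op_in[OF xv] by (intro Hk_inner_lincomb_left) auto
    also have "\<dots> = cnj \<mu> * Hk_inner e k ?x z + Hk_inner e k ?x w" by (simp only: zw(3)[OF xv])
    also have "\<dots> = Hk_inner e k ?x y" unfolding y_eq' by (rule Hk_inner_lincomb_right[OF zw(1,2), symmetric])
    finally show "Hk_inner e k u z = Hk_inner e k ?x y" .
  qed
  with y show "(y, z) \<in> {(y, adj_vec \<mu> y) |y. y \<in> X}" by auto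
next
  have \<mu>': "Re (cnj \<mu>) \<noteq> 0" using \<mu> by simp
  fix y z assume "(y, z) \<in> {(y, adj_vec \<mu> y) |y. y \<in> X}"
  then have y: "y \<in> X" and z_eq: "z = adj_vec \<mu> y" by auto
  have z: "z \<in> X" unfolding z_eq by (rule adj_vec_in[OF \<mu> y])
  \<comment> \<open>The only candidate for the value of the adjoint at \<open>z\<close>, obtained by
    solving \<open>y = w + \<mu> z\<close>.\<close>
  define w where "w = (\<lambda>n. (- \<mu>) * z n + y n)"
  have w: "w \<in> X" unfolding w_def by (rule ell2_diff_lincomb[OF z y])
  have "Hk_inner e k v z = Hk_inner e k x w" if xv: "(x, v) \<in> A_op f k" for x v
  proof -
    note A = A_op_in[OF xv]
    define u where "u = (\<lambda>n. cnj \<mu> * x n + v n)"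
    have u: "u \<in> X" unfolding u_def using A by (intro ell2_diff_lincomb) auto
    have "u = (\<lambda>n. \<i> * complex_of_real (f n) * x n + cnj \<mu> * x n)"
      using A by (auto simp: u_def)
    then have "R (cnj \<mu>) u = x" using R_left_inverse[OF \<mu>', of x] by simp
    then have "Hk_inner e k u z = Hk_inner e k x y"
      using Hk_inner_adj_vec[OF \<mu> y u] by (simp add: z_eq)
    moreover have "Hk_inner e k u z = cnj \<mu> * Hk_inner e k x z + Hk_inner e k v z"
      unfolding u_def using A by (intro Hk_inner_lincomb_left) auto
    moreover have "Hk_inner e k x w = cnj (- \<mu>) * Hk_inner e k x z + Hk_inner e k x y"
      unfolding w_def by (rule Hk_inner_lincomb_right[OF z y])
    ultimately have "Hk_inner e k v z + cnj \<mu> * Hk_inner e k x z = Hk_inner e k x w + cnj \<mu> * Hk_inner e k x z"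
      by (simp add: algebra_simps)
    then show ?thesis by simp
  qed
  then have "(z, w) \<in> Hk_adjoint e k (A_op f k)" using z w by (auto simp: Hk_adjoint_def)
  moreover have "y = (\<lambda>n. w n + \<mu> * z n)" by (auto simp: w_def)
  ultimately show "(y, z) \<in> (op_shift (Hk_adjoint e k (A_op f k)) \<mu>)\<inverse>"
    using op_shiftI by fastforce
qed

lemma bounded_adjoint_resolvent:
  assumes \<mu>: "Re \<mu> \<noteq> 0"
  shows "Hk_bounded_op e k ((op_shift (Hk_adjoint e k (A_op f k)) \<mu>)\<inverse>)"
proof -
  obtain g G where g: "orthonormal_basis (g :: nat \<Rightarrow> 'a)" "\<And>n. G n \<in> X" "\<And>n. J (G n) = g n"
    using orthonormal_coordinates by blast
  obtain N where N: "N > 0" "\<And>y u. y \<in> X \<Longrightarrow> u \<in> X \<Longrightarrow> cmod (cinner (J (R (cnj \<mu>) u)) (J y)) \<le>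
     (N * ((1 + (1 / \<bar>Re \<mu>\<bar>) ^ k) * (1 / \<bar>Re \<mu>\<bar>)) * Hk_norm e k y) * Hk_norm e k u"
    using adj_vec_bound \<mu> by blast
  have nn: "0 \<le> N * ((1 + (1 / \<bar>Re \<mu>\<bar>) ^ k) * (1 / \<bar>Re \<mu>\<bar>)) * Hk_norm e k y" for y
    using N(1) by (simp add: Hk_norm_def)
  show ?thesis
    unfolding converse_op_shift_adjoint[OF \<mu>]
  proof (rule Hk_bounded_op_graph)
    show "adj_vec \<mu> y \<in> X" if "y \<in> X" for y by (rule adj_vec_in[OF \<mu> that])
    show "Hk_norm e k (adj_vec \<mu> y) \<le> N * ((1 + (1 / \<bar>Re \<mu>\<bar>) ^ k) * (1 / \<bar>Re \<mu>\<bar>)) * Hk_norm e k y"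
      if "y \<in> X" for y
      by (rule adj_vec_properties(3)[OF \<mu> that g N(2)[OF that] nn])
    show "adj_vec \<mu> (\<lambda>n. \<alpha> * x n + y n) = (\<lambda>n. \<alpha> * adj_vec \<mu> x n + adj_vec \<mu> y n)"
      if x: "x \<in> X" and y: "y \<in> X" for \<alpha> x y
      by (rule adj_vec_eqI)
        (simp_all add: \<mu> x y ell2_diff_lincomb adj_vec_in Hk_inner_lincomb_right Hk_inner_adj_vec)
  qed
qed

end

section \<open>Integral estimates\<close>

lemma resolvent_energy_lincomb:
  assumes "\<And>n. p n \<ge> 0" "summable p" "\<And>n. q n \<ge> 0" "summable q" "Re \<mu> \<noteq> 0"
  shows "resolvent_energy f \<mu> (\<lambda>n. \<alpha> * p n + \<beta> * q n)
    = \<alpha> * resolvent_energy f \<mu> p + \<beta> * resolvent_energy f \<mu> q"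
proof -
  note P = resolvent_energy_bounds(1)[OF assms(1,2,5), of f]
  note Q = resolvent_energy_bounds(1)[OF assms(3,4,5), of f]
  have "(\<lambda>n. \<alpha> * ((cmod (resolvent_symbol f \<mu> n))\<^sup>2 * p n) + \<beta> * ((cmod (resolvent_symbol f \<mu> n))\<^sup>2 * q n))
    sums (\<alpha> * resolvent_energy f \<mu> p + \<beta> * resolvent_energy f \<mu> q)"
    unfolding resolvent_energy_def by (intro sums_add sums_mult summable_sums P Q)
  then show ?thesis
    by (simp add: resolvent_energy_def sums_iff algebra_simps)
qed

text \<open>The common final step of all the integral estimates: once an integrand is measurable and
  lies below a multiple of an energy, integrability and the factor \<open>pi / a\<close> follow
  together.\<close>

lemma integral_le_resolvent_energy:
  assumes q: "\<And>n. q n \<ge> 0" "summable q" and a: "a > 0" and \<sigma>: "\<sigma> \<in> {1, -1}"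
    and F: "F \<in> borel_measurable lborel" "\<And>s. 0 \<le> F s"
      "\<And>s. F s \<le> L * resolvent_energy f (\<sigma> * Complex a s) q"
  shows "integrable lborel F" and "(LINT s|lborel. F s) \<le> L * (pi / a * (\<Sum>n. q n))"
proof -
  note I = integral_resolvent_energy[OF q a \<sigma>, of f]
  have i: "integrable lborel (\<lambda>s. L * resolvent_energy f (\<sigma> * Complex a s) q)"
    by (rule integrable_mult_right[OF I(1)])
  show *: "integrable lborel F"
  proof (rule Bochner_Integration.integrable_bound[OF i F(1)])
    show "AE s in lborel. norm (F s) \<le> norm (L * resolvent_energy f (\<sigma> * Complex a s) q)"
      using F(2,3) by (intro AE_I2) (metis abs_of_nonneg order_trans real_norm_def)
  qed
  have "(LINT s|lborel. F s) \<le> (LINT s|lborel. L * resolvent_energy f (\<sigma> * Complex a s) q)"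
    by (rule integral_mono[OF * i F(3)])
  then show "(LINT s|lborel. F s) \<le> L * (pi / a * (\<Sum>n. q n))"
    by (simp only: integral_mult_right_zero I(2))
qed

context resolvent_setting
begin

lemma borel_measurable_R:
  assumes "\<sigma> \<in> {1, -1}" "a > 0" "\<And>n. (\<lambda>s. c s n) \<in> borel_measurable lborel"
  shows "(\<lambda>s. R (\<sigma> * Complex a s) (c s) n) \<in> borel_measurable lborel"
  unfolding R_def by (intro borel_measurable_times borel_measurable_resolvent_symbol assms)

lemma borel_measurable_R_cnj:
  assumes "\<sigma> \<in> {1, -1}" "a > 0"
  shows "(\<lambda>s. R (cnj (\<sigma> * Complex a s)) x n) \<in> borel_measurable lborel"
proof -
  have "continuous_on UNIV cnj" by (intro continuous_intros)
  from borel_measurable_continuous_on[OF this borel_measurable_resolvent_symbol[OF assms]]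
  have [measurable]: "(\<lambda>s. cnj (resolvent_symbol (\<lambda>n. - f n) (\<sigma> * Complex a s) n)) \<in> borel_measurable lborel" .
  show ?thesis unfolding R_def resolvent_symbol_cnj by measurable
qed

lemma weight_line:
  assumes "\<sigma> \<in> {1, -1}" "a > 0"
  shows "weight (\<sigma> * Complex a s) = 1 + 1 / a ^ (2 * k)" "weight (cnj (\<sigma> * Complex a s)) = 1 + 1 / a ^ (2 * k)"
  using assms by (auto simp: weight_def power_divide)

lemma Re_line:
  assumes "\<sigma> \<in> {1, -1 :: complex}" "a > 0"
  shows "Re (\<sigma> * Complex a s) \<noteq> 0"
  using assms by auto

section \<open>The integral estimates in terms of multipliers and adjoint vectors\<close>

lemma square_integral_resolvent:
  "\<exists>K>0. \<forall>a>0. \<forall>x\<in>X. \<forall>\<sigma>\<in>{1, -1 :: complex}.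
     integrable lborel (\<lambda>s. (Hk_norm e k (R (\<sigma> * Complex a s) x))\<^sup>2) \<and>
     (LINT s|lborel. (Hk_norm e k (R (\<sigma> * Complex a s) x))\<^sup>2) \<le> K / a * (1 + 1 / a ^ (2 * k)) * (Hk_norm e k x)\<^sup>2"
proof -
  obtain K where K: "K > 0" "\<forall>x\<in>X. \<exists>q. (\<forall>n. q n \<ge> 0) \<and> summable q \<and> (\<Sum>n. q n) \<le> (Hk_norm e k x)\<^sup>2 \<and>
      (\<forall>\<mu>. Re \<mu> \<noteq> 0 \<longrightarrow> R \<mu> x \<in> X \<and>
        (Hk_norm e k (R \<mu> x))\<^sup>2 \<le> K * weight \<mu> * resolvent_energy f \<mu> q)"
    using resolvent_estimates by blast
  show ?thesis
  proof (intro exI[of _ "K * pi"] conjI allI impI ballI)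
    show "K * pi > 0" using K(1) by simp
    fix a :: real and x and \<sigma> :: complex assume a: "a > 0" and x: "x \<in> X" and \<sigma>: "\<sigma> \<in> {1, -1}"
    obtain q where q: "\<And>n. q n \<ge> 0" "summable q" "(\<Sum>n. q n) \<le> (Hk_norm e k x)\<^sup>2"
      "\<And>\<mu>. Re \<mu> \<noteq> 0 \<Longrightarrow> (Hk_norm e k (R \<mu> x))\<^sup>2 \<le> K * weight \<mu> * resolvent_energy f \<mu> q"
      using K(2) x by blast
    let ?L = "K * (1 + 1 / a ^ (2 * k))"
    let ?F = "\<lambda>s. (Hk_norm e k (R (\<sigma> * Complex a s) x))\<^sup>2"
    have F: "?F s \<le> ?L * resolvent_energy f (\<sigma> * Complex a s) q" for s
      using q(4)[OF Re_line[OF \<sigma> a]] by (simp only: weight_line(1)[OF \<sigma> a])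
    have m: "?F \<in> borel_measurable lborel"
      by (intro borel_measurable_Hk_norm_power2 borel_measurable_R \<sigma> a R_in Re_line[OF \<sigma> a] x) simp
    note I = integral_le_resolvent_energy[OF q(1,2) a \<sigma> m zero_le_power2 F]
    show "integrable lborel ?F" by (rule I(1))
    have "?L * (pi / a * (\<Sum>n. q n)) \<le> ?L * (pi / a * (Hk_norm e k x)\<^sup>2)"
      using K(1) a by (intro mult_left_mono q(3)) simp_all
    with I(2) show "(LINT s|lborel. ?F s) \<le> K * pi / a * (1 + 1 / a ^ (2 * k)) * (Hk_norm e k x)\<^sup>2"
      by (simp add: mult_ac)
  qed
qed

lemma square_integral_adjoint_resolvent:
  "\<exists>K>0. \<forall>a>0. \<forall>y\<in>X. \<forall>\<sigma>\<in>{1, -1 :: complex}.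
     integrable lborel (\<lambda>s. (Hk_norm e k (adj_vec (\<sigma> * Complex a s) y))\<^sup>2) \<and>
     (LINT s|lborel. (Hk_norm e k (adj_vec (\<sigma> * Complex a s) y))\<^sup>2) \<le> K / a * (1 + 1 / a ^ (2 * k)) * (Hk_norm e k y)\<^sup>2"
proof -
  obtain K where K: "K > 0" "\<forall>y. \<exists>p. (\<forall>n. p n \<ge> 0) \<and> summable p \<and> (\<Sum>n. p n) \<le> (norm y)\<^sup>2 \<and>
      (\<forall>\<mu>. Re \<mu> \<noteq> 0 \<longrightarrow> (\<forall>x\<in>X.
        (cmod (cinner (J (R \<mu> x)) y))\<^sup>2 \<le> K * weight \<mu> * resolvent_energy f \<mu> p * (Hk_norm e k x)\<^sup>2))"
    using resolvent_estimates by blast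
  show ?thesis
  proof (intro exI[of _ "K * pi"] conjI allI impI ballI)
    show "K * pi > 0" using K(1) by simp
    fix a :: real and y and \<sigma> :: complex assume a: "a > 0" and y: "y \<in> X" and \<sigma>: "\<sigma> \<in> {1, -1}"
    obtain p where p: "\<And>n. p n \<ge> 0" "summable p" "(\<Sum>n. p n) \<le> (Hk_norm e k y)\<^sup>2"
      "\<And>\<mu> x. Re \<mu> \<noteq> 0 \<Longrightarrow> x \<in> X \<Longrightarrow>
        (cmod (cinner (J (R \<mu> x)) (J y)))\<^sup>2 \<le> K * weight \<mu> * resolvent_energy f \<mu> p * (Hk_norm e k x)\<^sup>2"
      using K(2)[rule_format, of "J y"] unfolding Hk_norm_def by blast
    obtain g G where g: "orthonormal_basis (g :: nat \<Rightarrow> 'a)" "\<And>n. G n \<in> X" "\<And>n. J (G n) = g n"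
      using orthonormal_coordinates by blast
    let ?L = "K * (1 + 1 / a ^ (2 * k))"
    let ?\<mu> = "\<lambda>s. \<sigma> * Complex a s"
    let ?F = "\<lambda>s. (Hk_norm e k (adj_vec (?\<mu> s) y))\<^sup>2"
    \<comment> \<open>For each \<open>s\<close> this bounds the functional
      \<open>u \<mapsto> \<langle>R u, y\<rangle>\<close> uniformly in \<open>u\<close>, hence also
      the norm of its representing vector; its square is the energy to be integrated. The sign of
      \<open>f\<close> accounts for the conjugate parameter.\<close>
    let ?N = "\<lambda>s. sqrt (?L * resolvent_energy (\<lambda>n. - f n) (?\<mu> s) p)"
    have L: "?L \<ge> 0" using K(1) a by simp
    have N0: "?L * resolvent_energy (\<lambda>n. - f n) (?\<mu> s) p \<ge> 0" for s
      by (intro mult_nonneg_nonneg L resolvent_energy_bounds(2)[OF p(1,2) Re_line[OF \<sigma> a]])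
    have N: "cmod (cinner (J (R (cnj (?\<mu> s)) u)) (J y)) \<le> ?N s * Hk_norm e k u" if u: "u \<in> X" for s u
    proof -
      have "Re (cnj (?\<mu> s)) \<noteq> 0" using Re_line[OF \<sigma> a] by simp
      from p(4)[OF this u]
      have "(cmod (cinner (J (R (cnj (?\<mu> s)) u)) (J y)))\<^sup>2
          \<le> ?L * resolvent_energy (\<lambda>n. - f n) (?\<mu> s) p * (Hk_norm e k u)\<^sup>2"
        by (simp only: weight_line(2)[OF \<sigma> a] resolvent_energy_cnj)
      also have "\<dots> = (?N s * Hk_norm e k u)\<^sup>2"
        by (simp only: power_mult_distrib real_sqrt_pow2[OF N0])
      finally show ?thesis
        by (rule power2_le_imp_le) (simp add: Hk_norm_def N0 del: real_sqrt_mult)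
    qed
    note A = adj_vec_properties[OF Re_line[OF \<sigma> a] y g N real_sqrt_ge_zero[OF N0]]
    have F: "?F s \<le> ?L * resolvent_energy (\<lambda>n. - f n) (?\<mu> s) p" for s
      using power_mono[OF A(3), of s 2] unfolding real_sqrt_pow2[OF N0] by (simp add: Hk_norm_def)
    have m: "?F \<in> borel_measurable lborel"
    proof -
      \<comment> \<open>Along the fixed vectors \<open>G n\<close> the norm is a countable sum of
        squared scalar functions of \<open>s\<close>, each measurable.\<close>
      have "?F s = (\<Sum>n. (cmod (cinner (J (R (cnj (?\<mu> s)) (G n))) (J y)))\<^sup>2)" for s
        by (rule sums_unique[OF A(4)])
      moreover have [measurable]: "(\<lambda>s. cinner (J (R (cnj (?\<mu> s)) (G n))) (J y)) \<in> borel_measurable lborel" for n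
        using Re_line[OF \<sigma> a]
        by (intro borel_measurable_cinner_J borel_measurable_R_cnj \<sigma> a R_in g(2)) simp
      have "(\<lambda>s. \<Sum>n. (cmod (cinner (J (R (cnj (?\<mu> s)) (G n))) (J y)))\<^sup>2) \<in> borel_measurable lborel"
        by measurable
      ultimately show ?thesis by simp
    qed
    note I = integral_le_resolvent_energy[OF p(1,2) a \<sigma> m zero_le_power2 F]
    show "integrable lborel ?F" by (rule I(1))
    have "?L * (pi / a * (\<Sum>n. p n)) \<le> ?L * (pi / a * (Hk_norm e k y)\<^sup>2)"
      using L a by (intro mult_left_mono p(3)) simp_all
    with I(2) show "(LINT s|lborel. ?F s) \<le> K * pi / a * (1 + 1 / a ^ (2 * k)) * (Hk_norm e k y)\<^sup>2"
      by (simp add: mult_ac)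
  qed
qed

text \<open>The estimate for the pairing is applied with \<open>R \<mu> x\<close> in place of
  \<open>x\<close>, and the norm of \<open>R \<mu> x\<close> is then estimated in turn. Each
  supplies one energy to the square of the integrand, so the integrand decays like a single
  energy.\<close>

lemma integral_resolvent_square:
  "\<exists>M>0. \<forall>a>0. \<forall>x\<in>X. \<forall>y\<in>X. \<forall>\<sigma>\<in>{1, -1 :: complex}.
     integrable lborel (\<lambda>s. cmod (Hk_inner e k (R (\<sigma> * Complex a s) (R (\<sigma> * Complex a s) x)) y)) \<and>
     (LINT s|lborel. cmod (Hk_inner e k (R (\<sigma> * Complex a s) (R (\<sigma> * Complex a s) x)) y))
       \<le> M / a * (1 + 1 / a ^ (2 * k)) * Hk_norm e k x * Hk_norm e k y"
proof -
  obtain K where K: "K > 0"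
    "\<forall>x\<in>X. \<exists>q. (\<forall>n. q n \<ge> 0) \<and> summable q \<and> (\<Sum>n. q n) \<le> (Hk_norm e k x)\<^sup>2 \<and>
      (\<forall>\<mu>. Re \<mu> \<noteq> 0 \<longrightarrow> R \<mu> x \<in> X \<and>
        (Hk_norm e k (R \<mu> x))\<^sup>2 \<le> K * weight \<mu> * resolvent_energy f \<mu> q)"
    "\<forall>y. \<exists>p. (\<forall>n. p n \<ge> 0) \<and> summable p \<and> (\<Sum>n. p n) \<le> (norm y)\<^sup>2 \<and>
      (\<forall>\<mu>. Re \<mu> \<noteq> 0 \<longrightarrow> (\<forall>x\<in>X.
        (cmod (cinner (J (R \<mu> x)) y))\<^sup>2 \<le> K * weight \<mu> * resolvent_energy f \<mu> p * (Hk_norm e k x)\<^sup>2))"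
    using resolvent_estimates by blast
  show ?thesis
  proof (intro exI[of _ "K * pi"] allI impI ballI conjI[OF mult_pos_pos[OF K(1) pi_gt_zero]])
    fix a :: real and x y and \<sigma> :: complex
    assume a: "a > 0" and x: "x \<in> X" and y: "y \<in> X" and \<sigma>: "\<sigma> \<in> {1, -1}"
    obtain q where q: "\<And>n. q n \<ge> 0" "summable q" "(\<Sum>n. q n) \<le> (Hk_norm e k x)\<^sup>2"
      "\<And>\<mu>. Re \<mu> \<noteq> 0 \<Longrightarrow> (Hk_norm e k (R \<mu> x))\<^sup>2 \<le> K * weight \<mu> * resolvent_energy f \<mu> q"
      using K(2) x by blast
    obtain p where p: "\<And>n. p n \<ge> 0" "summable p" "(\<Sum>n. p n) \<le> (Hk_norm e k y)\<^sup>2"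
      "\<And>\<mu> x. Re \<mu> \<noteq> 0 \<Longrightarrow> x \<in> X \<Longrightarrow>
        (cmod (cinner (J (R \<mu> x)) (J y)))\<^sup>2 \<le> K * weight \<mu> * resolvent_energy f \<mu> p * (Hk_norm e k x)\<^sup>2"
      using K(3)[rule_format, of "J y"] unfolding Hk_norm_def by blast
    let ?L = "K * (1 + 1 / a ^ (2 * k))"
    let ?\<mu> = "\<lambda>s. \<sigma> * Complex a s"
    let ?E = "\<lambda>s. resolvent_energy f (?\<mu> s)"
    let ?F = "\<lambda>s. cmod (Hk_inner e k (R (?\<mu> s) (R (?\<mu> s) x)) y)"
    let ?x = "Hk_norm e k x" and ?y = "Hk_norm e k y"
    note re = Re_line[OF \<sigma> a]
    have L: "?L \<ge> 0" using K(1) a by simp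
    have E0: "?E s q \<ge> 0" "?E s p \<ge> 0" for s
      using resolvent_energy_bounds(2)[OF q(1,2) re] resolvent_energy_bounds(2)[OF p(1,2) re] by auto
    have nn: "?x \<ge> 0" "?y \<ge> 0" by (simp_all add: Hk_norm_def)
    have F2: "(?F s)\<^sup>2 \<le> ?L\<^sup>2 * (?E s q * ?E s p)" for s
    proof -
      have "(?F s)\<^sup>2 \<le> ?L * ?E s p * (Hk_norm e k (R (?\<mu> s) x))\<^sup>2"
        using p(4)[OF re R_in[OF re x]] by (simp only: Hk_inner_def weight_line(1)[OF \<sigma> a])
      also have "\<dots> \<le> ?L * ?E s p * (?L * ?E s q)"
        by (rule mult_left_mono[OF _ mult_nonneg_nonneg[OF L E0(2)]])
          (use q(4)[OF re] in \<open>simp only: weight_line(1)[OF \<sigma> a]\<close>)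
      finally show ?thesis by (simp only: power2_eq_square mult_ac)
    qed
    have m: "?F \<in> borel_measurable lborel"
      unfolding Hk_inner_def
      by (intro measurable_compose[OF _ borel_measurable_norm] borel_measurable_cinner_J borel_measurable_R
          \<sigma> a R_in re x) simp_all
    show "integrable lborel ?F \<and>
      (LINT s|lborel. ?F s) \<le> K * pi / a * (1 + 1 / a ^ (2 * k)) * ?x * ?y"
    \<comment> \<open>The balancing parameter below is a quotient of the two norms; when one of them
      is 0 the integrand vanishes identically.\<close>
    proof (cases "?x = 0 \<or> ?y = 0")
      case True
      have "?F s = 0" for s
        using True
      proof
        assume "?x = 0"
        then have "?E s q \<le> 0"
          using resolvent_energy_bounds(3)[OF q(1,2) re, of f s] q(3)
          by (metis mult_nonneg_nonpos order_trans power_zero_numeral zero_le_power2)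
        then have "?E s q = 0" using E0(1) by (rule antisym)
        then show ?thesis using F2[of s] by simp
      next
        assume "?y = 0"
        then show ?thesis by (simp add: Hk_inner_def Hk_norm_def)
      qed
      then show ?thesis using True by auto
    next
      case False
      \<comment> \<open>The geometric mean of the two energies is at most \<open>t / 2\<close> times
        one plus \<open>1 / (2 * t)\<close> times the other. This \<open>t\<close> makes both parts
        contribute \<open>?x * ?y / 2\<close> after integration, giving the product of the
        norms.\<close>
      define t where "t = ?y / ?x"
      have t: "t > 0" using False nn by (simp add: t_def)
      let ?r = "\<lambda>n. t / 2 * q n + 1 / (2 * t) * p n"
      have r: "\<And>n. ?r n \<ge> 0" "summable ?r"
        using t q(1) p(1) by (auto intro!: summable_add summable_mult q(2) p(2) add_nonneg_nonneg mult_nonneg_nonneg)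
      have F: "?F s \<le> ?L * ?E s ?r" for s
      proof (rule power2_le_imp_le)
        have er: "?E s ?r = t / 2 * ?E s q + 1 / (2 * t) * ?E s p"
          by (rule resolvent_energy_lincomb[OF q(1,2) p(1,2) re])
        have "?E s q * ?E s p \<le> (t / 2 * ?E s q + 1 / (2 * t) * ?E s p)\<^sup>2"
        proof -
          \<comment> \<open>The square of the weighted mean exceeds the product exactly by a square,
            for every \<open>t > 0\<close>.\<close>
          have "(t / 2 * u + 1 / (2 * t) * v)\<^sup>2 = u * v + (t / 2 * u - 1 / (2 * t) * v)\<^sup>2" for u v :: real
            using t by (simp add: power2_eq_square field_simps)
          then show ?thesis by simp
        qed
        then show "(?F s)\<^sup>2 \<le> (?L * ?E s ?r)\<^sup>2"
          unfolding er power_mult_distrib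
          by (intro order_trans[OF F2[unfolded power_mult_distrib]] mult_left_mono) simp_all
        show "0 \<le> ?L * ?E s ?r"
          by (intro mult_nonneg_nonneg L resolvent_energy_bounds(2)[OF r re])
      qed
      note I = integral_le_resolvent_energy[OF r a \<sigma> m norm_ge_zero F]
      have "(\<Sum>n. ?r n) = t / 2 * (\<Sum>n. q n) + 1 / (2 * t) * (\<Sum>n. p n)"
        by (intro sums_unique[symmetric] sums_add sums_mult summable_sums q(2) p(2))
      also have "\<dots> \<le> t / 2 * ?x\<^sup>2 + 1 / (2 * t) * ?y\<^sup>2"
        using t by (intro add_mono mult_left_mono q(3) p(3)) simp_all
      also have "\<dots> = ?x * ?y"
        using False by (simp add: t_def power2_eq_square field_simps)
      finally have "?L * (pi / a * (\<Sum>n. ?r n)) \<le> ?L * (pi / a * (?x * ?y))"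
        using L a by (intro mult_left_mono) simp_all
      with I show ?thesis by (simp add: mult_ac)
    qed
  qed
qed

lemma op_app_resolvents:
  assumes that: "\<sigma> \<in> {1, -1}" "a > 0" "x \<in> X"
  shows "op_app ((op_shift (A_op f k) (\<sigma> * Complex a s))\<inverse>) x = R (\<sigma> * Complex a s) x"
    "op_app ((op_shift (A_op f k) (\<sigma> * Complex a s))\<inverse> ^^ 2) x = R (\<sigma> * Complex a s) (R (\<sigma> * Complex a s) x)"
    "op_app ((op_shift (Hk_adjoint e k (A_op f k)) (\<sigma> * Complex a s))\<inverse>) x = adj_vec (\<sigma> * Complex a s) x"
proof -
  note line = Re_line[OF that(1,2)]
  show "op_app ((op_shift (A_op f k) (\<sigma> * Complex a s))\<inverse>) x = R (\<sigma> * Complex a s) x"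
    by (simp only: converse_op_shift_A_op[OF line] op_app_graph[OF that(3)])
  show "op_app ((op_shift (A_op f k) (\<sigma> * Complex a s))\<inverse> ^^ 2) x = R (\<sigma> * Complex a s) (R (\<sigma> * Complex a s) x)"
    by (rule relpow2_graph[OF line that(3)])
  show "op_app ((op_shift (Hk_adjoint e k (A_op f k)) (\<sigma> * Complex a s))\<inverse>) x = adj_vec (\<sigma> * Complex a s) x"
    by (simp only: converse_op_shift_adjoint[OF line] op_app_graph[OF that(3)])
qed

lemma resolvent_weak_integral_estimate:
  "\<exists>M>0. \<forall>a>0. \<forall>x\<in>ell2_diff k. \<forall>y\<in>ell2_diff k. \<forall>\<sigma>\<in>{1, -1 :: complex}.
        (\<forall>s. Hk_bounded_op e k ((op_shift (A_op f k) (\<sigma> * Complex a s))\<inverse>)) \<and>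
        integrable lborel (\<lambda>s. cmod (Hk_inner e k
          (op_app ((op_shift (A_op f k) (\<sigma> * Complex a s))\<inverse> ^^ 2) x) y)) \<and>
        (LINT s|lborel. cmod (Hk_inner e k
          (op_app ((op_shift (A_op f k) (\<sigma> * Complex a s))\<inverse> ^^ 2) x) y))
        \<le> M / a * (1 + 1 / a ^ (2 * k)) * Hk_norm e k x * Hk_norm e k y"
proof -
  obtain M where M: "M > 0 \<and> (\<forall>a>0. \<forall>x\<in>ell2_diff k. \<forall>y\<in>ell2_diff k. \<forall>\<sigma>\<in>{1, -1 :: complex}.
     integrable lborel (\<lambda>s. cmod (Hk_inner e k (R (\<sigma> * Complex a s) (R (\<sigma> * Complex a s) x)) y)) \<and>
     (LINT s|lborel. cmod (Hk_inner e k (R (\<sigma> * Complex a s) (R (\<sigma> * Complex a s) x)) y))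
       \<le> M / a * (1 + 1 / a ^ (2 * k)) * Hk_norm e k x * Hk_norm e k y)"
    using integral_resolvent_square ..
  note M = conjunct1[OF M] conjunct2[OF M]
  show ?thesis
  proof (intro exI[of _ M] conjI[OF M(1)] allI impI ballI)
    fix a :: real and x y and \<sigma> :: complex
    assume *: "a > 0" "x \<in> ell2_diff k" "y \<in> ell2_diff k" "\<sigma> \<in> {1, -1}"
    have b: "\<forall>s. Hk_bounded_op e k ((op_shift (A_op f k) (\<sigma> * Complex a s))\<inverse>)"
      using bounded_resolvent[OF Re_line[OF *(4,1)]] ..
    show "(\<forall>s. Hk_bounded_op e k ((op_shift (A_op f k) (\<sigma> * Complex a s))\<inverse>)) \<and>
      integrable lborel (\<lambda>s. cmod (Hk_inner e k
        (op_app ((op_shift (A_op f k) (\<sigma> * Complex a s))\<inverse> ^^ 2) x) y)) \<and>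
      (LINT s|lborel. cmod (Hk_inner e k
        (op_app ((op_shift (A_op f k) (\<sigma> * Complex a s))\<inverse> ^^ 2) x) y))
      \<le> M / a * (1 + 1 / a ^ (2 * k)) * Hk_norm e k x * Hk_norm e k y"
      unfolding op_app_resolvents(2)[OF *(4,1,2)]
      by (rule conjI[OF b M(2)[THEN spec, THEN mp, OF *(1), THEN bspec, OF *(2),
              THEN bspec, OF *(3), THEN bspec, OF *(4)]])
  qed
qed

lemma resolvent_square_integral_estimate:
  "\<exists>K>0. \<forall>a>0. \<forall>x\<in>ell2_diff k. \<forall>y\<in>ell2_diff k. \<forall>\<sigma>\<in>{1, -1 :: complex}.
        (\<forall>s. Hk_bounded_op e k ((op_shift (A_op f k) (\<sigma> * Complex a s))\<inverse>)) \<and>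
        integrable lborel (\<lambda>s. (Hk_norm e k
          (op_app ((op_shift (A_op f k) (\<sigma> * Complex a s))\<inverse>) x))\<^sup>2) \<and>
        (LINT s|lborel. (Hk_norm e k
          (op_app ((op_shift (A_op f k) (\<sigma> * Complex a s))\<inverse>) x))\<^sup>2)
        \<le> K / a * (1 + 1 / a ^ (2 * k)) * (Hk_norm e k x)\<^sup>2 \<and>
        (\<forall>s. Hk_bounded_op e k ((op_shift (Hk_adjoint e k (A_op f k)) (\<sigma> * Complex a s))\<inverse>)) \<and>
        integrable lborel (\<lambda>s. (Hk_norm e k
          (op_app ((op_shift (Hk_adjoint e k (A_op f k)) (\<sigma> * Complex a s))\<inverse>) y))\<^sup>2) \<and>
        (LINT s|lborel. (Hk_norm e k
          (op_app ((op_shift (Hk_adjoint e k (A_op f k)) (\<sigma> * Complex a s))\<inverse>) y))\<^sup>2)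
        \<le> K / a * (1 + 1 / a ^ (2 * k)) * (Hk_norm e k y)\<^sup>2"
proof -
  obtain K1 where K1: "K1 > 0 \<and> (\<forall>a>0. \<forall>x\<in>ell2_diff k. \<forall>\<sigma>\<in>{1, -1 :: complex}.
     integrable lborel (\<lambda>s. (Hk_norm e k (R (\<sigma> * Complex a s) x))\<^sup>2) \<and>
     (LINT s|lborel. (Hk_norm e k (R (\<sigma> * Complex a s) x))\<^sup>2) \<le> K1 / a * (1 + 1 / a ^ (2 * k)) * (Hk_norm e k x)\<^sup>2)"
    using square_integral_resolvent ..
  note K1 = conjunct1[OF K1] conjunct2[OF K1]
  obtain K2 where K2: "K2 > 0 \<and> (\<forall>a>0. \<forall>y\<in>ell2_diff k. \<forall>\<sigma>\<in>{1, -1 :: complex}.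
     integrable lborel (\<lambda>s. (Hk_norm e k (adj_vec (\<sigma> * Complex a s) y))\<^sup>2) \<and>
     (LINT s|lborel. (Hk_norm e k (adj_vec (\<sigma> * Complex a s) y))\<^sup>2) \<le> K2 / a * (1 + 1 / a ^ (2 * k)) * (Hk_norm e k y)\<^sup>2)"
    using square_integral_adjoint_resolvent ..
  note K2 = conjunct1[OF K2] conjunct2[OF K2]
  define K where "K = max K1 K2"
  have mono: "K' / a * (1 + 1 / a ^ (2 * k)) * (Hk_norm e k x)\<^sup>2 \<le> K / a * (1 + 1 / a ^ (2 * k)) * (Hk_norm e k x)\<^sup>2"
    if "K' \<le> K" "a > 0" for K' a x
  proof (rule mult_right_mono[OF mult_right_mono])
    show "K' / a \<le> K / a" using that by (simp add: divide_right_mono)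
    show "0 \<le> 1 + 1 / a ^ (2 * k)" using that by (simp add: add_nonneg_nonneg)
  qed simp
  show ?thesis
  proof (intro exI[of _ K] allI impI ballI conjI[of "K > 0"])
    show "K > 0" using K1(1) by (simp add: K_def)
    fix a :: real and x y and \<sigma> :: complex
    assume *: "a > 0" "x \<in> ell2_diff k" "y \<in> ell2_diff k" "\<sigma> \<in> {1, -1}"
    have le: "K1 \<le> K" "K2 \<le> K" by (simp_all add: K_def)
    note I1 = K1(2)[THEN spec, THEN mp, OF *(1), THEN bspec, OF *(2), THEN bspec, OF *(4)]
      and I2 = K2(2)[THEN spec, THEN mp, OF *(1), THEN bspec, OF *(3), THEN bspec, OF *(4)]
    note le1 = order_trans[OF conjunct2[OF I1] mono[OF le(1) *(1)]]
      and le2 = order_trans[OF conjunct2[OF I2] mono[OF le(2) *(1)]]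
    have b: "\<forall>s. Hk_bounded_op e k ((op_shift (A_op f k) (\<sigma> * Complex a s))\<inverse>)"
      "\<forall>s. Hk_bounded_op e k ((op_shift (Hk_adjoint e k (A_op f k)) (\<sigma> * Complex a s))\<inverse>)"
      by (rule allI, rule bounded_resolvent bounded_adjoint_resolvent, rule Re_line[OF *(4,1)])+
    show "(\<forall>s. Hk_bounded_op e k ((op_shift (A_op f k) (\<sigma> * Complex a s))\<inverse>)) \<and>
      integrable lborel (\<lambda>s. (Hk_norm e k
        (op_app ((op_shift (A_op f k) (\<sigma> * Complex a s))\<inverse>) x))\<^sup>2) \<and>
      (LINT s|lborel. (Hk_norm e k
        (op_app ((op_shift (A_op f k) (\<sigma> * Complex a s))\<inverse>) x))\<^sup>2)
      \<le> K / a * (1 + 1 / a ^ (2 * k)) * (Hk_norm e k x)\<^sup>2 \<and>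
      (\<forall>s. Hk_bounded_op e k ((op_shift (Hk_adjoint e k (A_op f k)) (\<sigma> * Complex a s))\<inverse>)) \<and>
      integrable lborel (\<lambda>s. (Hk_norm e k
        (op_app ((op_shift (Hk_adjoint e k (A_op f k)) (\<sigma> * Complex a s))\<inverse>) y))\<^sup>2) \<and>
      (LINT s|lborel. (Hk_norm e k
        (op_app ((op_shift (Hk_adjoint e k (A_op f k)) (\<sigma> * Complex a s))\<inverse>) y))\<^sup>2)
      \<le> K / a * (1 + 1 / a ^ (2 * k)) * (Hk_norm e k y)\<^sup>2"
      unfolding op_app_resolvents(1)[OF *(4,1,2)] op_app_resolvents(3)[OF *(4,1,3)]
      by (intro conjI b conjunct1[OF I1] le1 conjunct1[OF I2] le2)
  qed
qed

end

text \<open>The sign is carried by \<open>\<sigma>\<close> and \<open>a + is\<close> is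
  \<open>Complex a s\<close>. Integrability is asserted explicitly because the integral of a
  non-integrable function is 0 by default, and boundedness of the inverses because
  \<open>op_app\<close> and \<open>Hk_opnorm\<close> are informative only for relations that are
  everywhere defined bounded operators.\<close>

theorem theorem4p1:
  fixes e :: "nat \<Rightarrow> 'h::complex_hilbert" and k :: nat and f :: "nat \<Rightarrow> real"
  assumes "riesz_basis e" and "k \<ge> 1" and "f \<in> S_class k"
  shows
    "(\<forall>a>0. \<exists>C>0.
        (\<forall>l. 0 < \<bar>Re l\<bar> \<and> \<bar>Re l\<bar> < a \<longrightarrow>
           Hk_bounded_op e k ((op_shift (A_op f k) (- l))\<inverse>) \<and>
           Hk_opnorm e k ((op_shift (A_op f k) (- l))\<inverse>) \<le> C / \<bar>Re l\<bar> ^ (k + 1)) \<and>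
        (\<forall>l. \<bar>Re l\<bar> \<ge> a \<longrightarrow>
           Hk_bounded_op e k ((op_shift (A_op f k) (- l))\<inverse>) \<and>
           Hk_opnorm e k ((op_shift (A_op f k) (- l))\<inverse>) \<le> C))
     \<and>
     (\<exists>M>0. \<forall>a>0. \<forall>x\<in>ell2_diff k. \<forall>y\<in>ell2_diff k. \<forall>\<sigma>\<in>{1, -1 :: complex}.
        (\<forall>s. Hk_bounded_op e k ((op_shift (A_op f k) (\<sigma> * Complex a s))\<inverse>)) \<and>
        integrable lborel (\<lambda>s. cmod (Hk_inner e k
          (op_app ((op_shift (A_op f k) (\<sigma> * Complex a s))\<inverse> ^^ 2) x) y)) \<and>
        (LINT s|lborel. cmod (Hk_inner e k
          (op_app ((op_shift (A_op f k) (\<sigma> * Complex a s))\<inverse> ^^ 2) x) y))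
        \<le> M / a * (1 + 1 / a ^ (2 * k)) * Hk_norm e k x * Hk_norm e k y)
     \<and>
     (\<exists>K>0. \<forall>a>0. \<forall>x\<in>ell2_diff k. \<forall>y\<in>ell2_diff k. \<forall>\<sigma>\<in>{1, -1 :: complex}.
        (\<forall>s. Hk_bounded_op e k ((op_shift (A_op f k) (\<sigma> * Complex a s))\<inverse>)) \<and>
        integrable lborel (\<lambda>s. (Hk_norm e k
          (op_app ((op_shift (A_op f k) (\<sigma> * Complex a s))\<inverse>) x))\<^sup>2) \<and>
        (LINT s|lborel. (Hk_norm e k
          (op_app ((op_shift (A_op f k) (\<sigma> * Complex a s))\<inverse>) x))\<^sup>2)
        \<le> K / a * (1 + 1 / a ^ (2 * k)) * (Hk_norm e k x)\<^sup>2 \<and>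
        (\<forall>s. Hk_bounded_op e k ((op_shift (Hk_adjoint e k (A_op f k)) (\<sigma> * Complex a s))\<inverse>)) \<and>
        integrable lborel (\<lambda>s. (Hk_norm e k
          (op_app ((op_shift (Hk_adjoint e k (A_op f k)) (\<sigma> * Complex a s))\<inverse>) y))\<^sup>2) \<and>
        (LINT s|lborel. (Hk_norm e k
          (op_app ((op_shift (Hk_adjoint e k (A_op f k)) (\<sigma> * Complex a s))\<inverse>) y))\<^sup>2)
        \<le> K / a * (1 + 1 / a ^ (2 * k)) * (Hk_norm e k y)\<^sup>2)"
proof -
  interpret resolvent_setting e k f using assms(1,3) by unfold_locales
  show ?thesis
    by (rule conjI[OF resolvent_norm_estimate
          conjI[OF resolvent_weak_integral_estimate resolvent_square_integral_estimate]])
qed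

end
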